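(* Let $M$ be an orientable manifold, with (possibly empty) boundary $\partial M$, and let $U\subseteq M$ be a closed subset such that $\partial M\cap U=\emptyset$ and $M-U$ is connected; all manifolds (in particular $M$ and $M-U$) are assumed to be of finite type. Suppose that $\partial M\cup U\neq\emptyset$. Then for each $i\geq 0$ the map $$k\mapsto \dim H_{i}(C_{k}(M-U);\mathbb{Q})$$ is monotonically increasing (in the non-strict sense, i.e. non-decreasing in $k$).
   Context: For a manifold $N$ and a positive integer $k$, $F_{k}(N)=\{(x_{1},\ldots,x_{k})\in N^{k} : x_{i}\neq x_{j}\text{ for } i\neq j\}$, with the induced topology, is the configuration space of $k$ distinct ordered points in $N$. The symmetric group $S_{k}$ acts on $F_{k}(N)$ by permuting coordinates, and $C_{k}(N)=F_{k}(N)/S_{k}$, with the quotient topology, is the unordered configuration space. The boundary of $M$ is denoted $\partial M$. A manifold is of finite type if its Betti numbers are finite.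
   Formalization: M is additionally assumed connected; otherwise the claim fails, e.g. for M a disjoint union of two 2-spheres and U one of them, where dim H_2(C_k(M-U);Q) is 1 for k=1 and 0 for k=2. *)

theory Defs
  imports
    "HOL-Analysis.Analysis"
    "HOL-Homology.Homology"
    "Jordan_Normal_Form.VS_Connect"
begin

section \<open>Singular homology with rational coefficients\<close>

type_synonym 'a rat_chain = "((nat \<Rightarrow> real) \<Rightarrow> 'a) \<Rightarrow>\<^sub>0 rat"

definition rat_scale :: "rat \<Rightarrow> 'a rat_chain \<Rightarrow> 'a rat_chain" where
  "rat_scale q c = Poly_Mapping.map ((*) q) c"

definition rat_chains :: "nat \<Rightarrow> 'a topology \<Rightarrow> 'a rat_chain set" where
  "rat_chains p X = {c. Poly_Mapping.keys c \<subseteq> singular_simplex_set p X}"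

definition rat_boundary :: "nat \<Rightarrow> 'a rat_chain \<Rightarrow> 'a rat_chain" where
  "rat_boundary p c =
     (if p = 0 then 0
      else \<Sum>f\<in>Poly_Mapping.keys c. \<Sum>k\<le>p.
             Poly_Mapping.single (singular_face p k f) ((-1) ^ k * Poly_Mapping.lookup c f))"

definition rat_cycles :: "nat \<Rightarrow> 'a topology \<Rightarrow> 'a rat_chain set" where
  "rat_cycles p X = {c \<in> rat_chains p X. rat_boundary p c = 0}"

definition rat_boundaries :: "nat \<Rightarrow> 'a topology \<Rightarrow> 'a rat_chain set" where
  "rat_boundaries p X = rat_boundary (Suc p) ` rat_chains (Suc p) X"

definition rat_class :: "nat \<Rightarrow> 'a topology \<Rightarrow> 'a rat_chain \<Rightarrow> 'a rat_chain set" where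
  "rat_class p X c = (\<lambda>b. c + b) ` rat_boundaries p X"

text \<open>
  The quotient of cycles by boundaries, as a rational vector space of cosets. The extra
  summand from the boundaries in the scalar multiplication matters only for the scalar 0.
  Modules are records extending rings, so the ring multiplication and unit have to be filled in;
  they play no role.
\<close>

definition rat_homology :: "nat \<Rightarrow> 'a topology \<Rightarrow> (rat, 'a rat_chain set) module" where
  "rat_homology p X =
     \<lparr>carrier = rat_class p X ` rat_cycles p X,
      mult = (\<lambda>A B. rat_boundaries p X),
      one = rat_boundaries p X,
      zero = rat_boundaries p X,
      add = (\<lambda>A B. {a + b | a b. a \<in> A \<and> b \<in> B}),
      smult = (\<lambda>q A. {rat_scale q a + b | a b. a \<in> A \<and> b \<in> rat_boundaries p X})\<rparr>"

lemma lookup_rat_scale [simp]: "Poly_Mapping.lookup (rat_scale q c) f = q * Poly_Mapping.lookup c f"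
  unfolding rat_scale_def by (simp add: Poly_Mapping.map.rep_eq when_def)

lemma keys_rat_scale: "Poly_Mapping.keys (rat_scale q c) \<subseteq> Poly_Mapping.keys c"
  by (auto simp: in_keys_iff)

lemma rat_boundary_superset:
  assumes "finite S" "Poly_Mapping.keys c \<subseteq> S" "p \<noteq> 0"
  shows "rat_boundary p c =
     (\<Sum>f\<in>S. \<Sum>k\<le>p. Poly_Mapping.single (singular_face p k f) ((-1) ^ k * Poly_Mapping.lookup c f))"
  unfolding rat_boundary_def using assms
  by (auto intro!: sum.mono_neutral_left simp: in_keys_iff)

lemma rat_boundary_0 [simp]: "rat_boundary p 0 = 0"
  by (simp add: rat_boundary_def)

lemma rat_boundary_add: "rat_boundary p (c + d) = rat_boundary p c + rat_boundary p d"
proof (cases "p = 0")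
  case False
  let ?S = "Poly_Mapping.keys c \<union> Poly_Mapping.keys d"
  have 1: "rat_boundary p e =
     (\<Sum>f\<in>?S. \<Sum>k\<le>p. Poly_Mapping.single (singular_face p k f) ((-1) ^ k * Poly_Mapping.lookup e f))"
    if "Poly_Mapping.keys e \<subseteq> ?S" for e
    using that False by (intro rat_boundary_superset) auto
  show ?thesis
    using Poly_Mapping.keys_add[of c d]
    by (simp add: 1 lookup_add algebra_simps single_add sum.distrib)
qed (simp add: rat_boundary_def)

lemma rat_scale_add: "rat_scale q (c + d) = rat_scale q c + rat_scale q d"
  by (rule poly_mapping_eqI) (simp add: lookup_add algebra_simps)

lemma rat_scale_add_left: "rat_scale (q + r) c = rat_scale q c + rat_scale r c"
  by (rule poly_mapping_eqI) (simp add: lookup_add algebra_simps)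

lemma rat_scale_scale: "rat_scale q (rat_scale r c) = rat_scale (q * r) c"
  by (rule poly_mapping_eqI) (simp add: algebra_simps)

lemma rat_scale_1 [simp]: "rat_scale 1 c = c"
  by (rule poly_mapping_eqI) simp

lemma rat_scale_0 [simp]: "rat_scale q 0 = 0" "rat_scale 0 c = 0"
  by (rule poly_mapping_eqI; simp)+

lemma rat_scale_m1: "rat_scale (-1) c = - c"
  by (rule poly_mapping_eqI) simp

lemma rat_scale_single: "rat_scale q (Poly_Mapping.single f r) = Poly_Mapping.single f (q * r)"
  by (rule poly_mapping_eqI) (simp add: lookup_single when_def)

lemma rat_scale_sum: "rat_scale q (\<Sum>x\<in>A. g x) = (\<Sum>x\<in>A. rat_scale q (g x))"
  by (induction A rule: infinite_finite_induct) (auto simp: rat_scale_add)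

lemma rat_boundary_scale: "rat_boundary p (rat_scale q c) = rat_scale q (rat_boundary p c)"
proof (cases "p = 0")
  case False
  show ?thesis
    using rat_boundary_superset[OF finite_keys keys_rat_scale False, of q c]
    using rat_boundary_superset[OF finite_keys order_refl False, of c]
    by (simp add: rat_scale_sum rat_scale_single mult.left_commute)
qed (simp add: rat_boundary_def)

lemma rat_chains_closed:
  "0 \<in> rat_chains p X"
  "c \<in> rat_chains p X \<Longrightarrow> d \<in> rat_chains p X \<Longrightarrow> c + d \<in> rat_chains p X"
  "c \<in> rat_chains p X \<Longrightarrow> rat_scale q c \<in> rat_chains p X"
  using Poly_Mapping.keys_add[of c d] keys_rat_scale[of q c] by (auto simp: rat_chains_def)

lemma rat_cycles_closed:
  "0 \<in> rat_cycles p X"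
  "c \<in> rat_cycles p X \<Longrightarrow> d \<in> rat_cycles p X \<Longrightarrow> c + d \<in> rat_cycles p X"
  "c \<in> rat_cycles p X \<Longrightarrow> rat_scale q c \<in> rat_cycles p X"
  by (auto simp: rat_cycles_def rat_chains_closed rat_boundary_add rat_boundary_scale)

lemma rat_boundaries_closed:
  "0 \<in> rat_boundaries p X"
  "c \<in> rat_boundaries p X \<Longrightarrow> d \<in> rat_boundaries p X \<Longrightarrow> c + d \<in> rat_boundaries p X"
  "c \<in> rat_boundaries p X \<Longrightarrow> rat_scale q c \<in> rat_boundaries p X"
proof -
  show "0 \<in> rat_boundaries p X"
    using rat_chains_closed(1)[of "Suc p" X] rat_boundary_0[of "Suc p"]
    unfolding rat_boundaries_def by (metis imageI)
qed (auto simp: rat_boundaries_def rat_chains_closed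
       simp flip: rat_boundary_add rat_boundary_scale)

lemma rat_class_0: "rat_class p X 0 = rat_boundaries p X"
  by (simp add: rat_class_def)

lemma rat_class_add:
  "{a + b | a b. a \<in> rat_class p X c \<and> b \<in> rat_class p X d} = rat_class p X (c + d)" (is "?L = ?R")
proof
  show "?L \<subseteq> ?R"
    unfolding rat_class_def using rat_boundaries_closed(2)
    by (auto simp: image_iff algebra_simps) blast
  show "?R \<subseteq> ?L"
  proof
    fix x assume "x \<in> ?R"
    then obtain b where b: "b \<in> rat_boundaries p X" "x = (c + b) + (d + 0)"
      by (auto simp: rat_class_def algebra_simps)
    then show "x \<in> ?L" using rat_boundaries_closed(1) unfolding rat_class_def by blast
  qed
qed

lemma rat_class_scale:
  "{rat_scale q a + b | a b. a \<in> rat_class p X c \<and> b \<in> rat_boundaries p X} =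
     rat_class p X (rat_scale q c)" (is "?L = ?R")
proof
  show "?L \<subseteq> ?R"
  proof
    fix x assume "x \<in> ?L"
    then obtain b b' where b: "b \<in> rat_boundaries p X" "b' \<in> rat_boundaries p X"
        "x = rat_scale q c + (rat_scale q b + b')"
      by (auto simp: rat_class_def rat_scale_add add.assoc)
    then have "rat_scale q b + b' \<in> rat_boundaries p X"
      by (intro rat_boundaries_closed)
    then show "x \<in> ?R" unfolding rat_class_def b(3) by (rule imageI)
  qed
  show "?R \<subseteq> ?L"
  proof
    fix x assume "x \<in> ?R"
    then obtain b where b: "b \<in> rat_boundaries p X" "x = rat_scale q (c + 0) + b"
      by (auto simp: rat_class_def algebra_simps)
    then show "x \<in> ?L" using rat_boundaries_closed(1) unfolding rat_class_def by blast
  qed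
qed

lemma rat_homology_simps:
  "carrier (rat_homology p X) = rat_class p X ` rat_cycles p X"
  "\<zero>\<^bsub>rat_homology p X\<^esub> = rat_class p X 0"
  "rat_class p X c \<oplus>\<^bsub>rat_homology p X\<^esub> rat_class p X d = rat_class p X (c + d)"
  "q \<odot>\<^bsub>rat_homology p X\<^esub> rat_class p X c = rat_class p X (rat_scale q c)"
  by (simp_all add: rat_homology_def rat_class_0 rat_class_add rat_class_scale)

lemma vectorspace_rat_homology: "vectorspace class_ring (rat_homology p X)"
proof -
  have ab: "abelian_group (rat_homology p X)"
  proof (rule abelian_groupI)
    fix x assume "x \<in> carrier (rat_homology p X)"
    then obtain c where c: "c \<in> rat_cycles p X" "x = rat_class p X c"
      by (auto simp: rat_homology_simps)
    have "- c \<in> rat_cycles p X"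
      using rat_cycles_closed(3)[OF c(1), of "-1"] by (simp add: rat_scale_m1)
    moreover have "rat_class p X (- c) \<oplus>\<^bsub>rat_homology p X\<^esub> x = \<zero>\<^bsub>rat_homology p X\<^esub>"
      by (simp add: rat_homology_simps c)
    ultimately show "\<exists>y\<in>carrier (rat_homology p X). y \<oplus>\<^bsub>rat_homology p X\<^esub> x = \<zero>\<^bsub>rat_homology p X\<^esub>"
      by (auto simp: rat_homology_simps(1))
  qed (auto simp: rat_homology_simps rat_cycles_closed add_ac)
  have "module class_ring (rat_homology p X)"
    by (rule moduleI[OF class_cring.is_cring ab])
       (auto simp: rat_homology_simps rat_cycles_closed
         rat_scale_add rat_scale_add_left rat_scale_scale)
  then show ?thesis
    by (simp add: vectorspace_def class_field.field_axioms)
qed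

text \<open>
  \<open>vectorspace.dim\<close> is unspecified for spaces that are not finitely generated, hence the explicit
  case distinction.
\<close>

definition betti :: "nat \<Rightarrow> 'a topology \<Rightarrow> enat" where
  "betti p X =
     (if vectorspace.fin_dim class_ring (rat_homology p X)
      then enat (vectorspace.dim class_ring (rat_homology p X)) else \<infinity>)"

definition finite_type :: "'a topology \<Rightarrow> bool" where
  "finite_type X \<longleftrightarrow> (\<forall>p. betti p X \<noteq> \<infinity>)"


section \<open>Topological manifolds with boundary\<close>

text \<open>For \<open>n = 0\<close> the half-space is the one-point space \<open>Euclidean_space 0\<close>.\<close>

definition half_space :: "nat \<Rightarrow> (nat \<Rightarrow> real) topology" where
  "half_space n = subtopology (Euclidean_space n) {x. 0 \<le> x 0}"

definition locally_modelled_at :: "'a topology \<Rightarrow> 'b topology \<Rightarrow> 'a \<Rightarrow> bool" where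
  "locally_modelled_at X E x \<longleftrightarrow>
     (\<exists>V W. openin X V \<and> x \<in> V \<and> openin E W \<and>
            subtopology X V homeomorphic_space subtopology E W)"

definition manifold_with_boundary :: "nat \<Rightarrow> 'a topology \<Rightarrow> bool" where
  "manifold_with_boundary n X \<longleftrightarrow>
     Hausdorff_space X \<and> second_countable X \<and>
     (\<forall>x \<in> topspace X. locally_modelled_at X (half_space n) x)"

definition manifold_interior :: "nat \<Rightarrow> 'a topology \<Rightarrow> 'a set" where
  "manifold_interior n X = {x \<in> topspace X. locally_modelled_at X (Euclidean_space n) x}"

definition manifold_boundary :: "nat \<Rightarrow> 'a topology \<Rightarrow> 'a set" where
  "manifold_boundary n X = topspace X - manifold_interior n X"

text \<open>
  An orientation of a manifold without boundary is a choice, at each point \<open>x\<close>, of a generator of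
  the local homology group \<open>H\<^sub>n(X, X - x)\<close> with integer coefficients, such that near each point
  the choices are the restrictions of one class in \<open>H\<^sub>n(X, X - V)\<close>. A manifold with boundary is
  orientable if its interior is.
\<close>

definition is_orientation :: "nat \<Rightarrow> 'a topology \<Rightarrow> ('a \<Rightarrow> 'a chain set) \<Rightarrow> bool" where
  "is_orientation n X \<mu> \<longleftrightarrow>
     (\<forall>x \<in> topspace X.
        \<mu> x \<in> carrier (relative_homology_group (int n) X (topspace X - {x})) \<and>
        generate (relative_homology_group (int n) X (topspace X - {x})) {\<mu> x} =
          carrier (relative_homology_group (int n) X (topspace X - {x})) \<and>
        (\<exists>V \<alpha>. openin X V \<and> x \<in> V \<and>
               \<alpha> \<in> carrier (relative_homology_group (int n) X (topspace X - V)) \<and>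
               (\<forall>y \<in> V. hom_induced (int n) X (topspace X - V) X (topspace X - {y}) id \<alpha> = \<mu> y)))"

definition orientable_manifold :: "nat \<Rightarrow> 'a topology \<Rightarrow> bool" where
  "orientable_manifold n X \<longleftrightarrow>
     manifold_with_boundary n X \<and>
     (\<exists>\<mu>. is_orientation n (subtopology X (manifold_interior n X)) \<mu>)"


section \<open>Configuration spaces\<close>

definition quotient_topology :: "'a topology \<Rightarrow> ('a \<Rightarrow> 'b) \<Rightarrow> 'b topology" where
  "quotient_topology X q =
     topology (\<lambda>U. U \<subseteq> q ` topspace X \<and> openin X {x \<in> topspace X. q x \<in> U})"

lemma openin_quotient_topology:
  "openin (quotient_topology X q) U \<longleftrightarrow>
     U \<subseteq> q ` topspace X \<and> openin X {x \<in> topspace X. q x \<in> U}"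
proof -
  have "istopology (\<lambda>U. U \<subseteq> q ` topspace X \<and> openin X {x \<in> topspace X. q x \<in> U})"
    unfolding istopology_def
  proof (intro conjI allI impI)
    fix S T
    assume "S \<subseteq> q ` topspace X \<and> openin X {x \<in> topspace X. q x \<in> S}"
      and "T \<subseteq> q ` topspace X \<and> openin X {x \<in> topspace X. q x \<in> T}"
    moreover have "{x \<in> topspace X. q x \<in> S \<inter> T} =
        {x \<in> topspace X. q x \<in> S} \<inter> {x \<in> topspace X. q x \<in> T}" by auto
    ultimately show "openin X {x \<in> topspace X. q x \<in> S \<inter> T}" by auto
  next
    fix \<K>
    assume K: "\<forall>K\<in>\<K>. K \<subseteq> q ` topspace X \<and> openin X {x \<in> topspace X. q x \<in> K}"
    have "{x \<in> topspace X. q x \<in> \<Union>\<K>} = (\<Union>K\<in>\<K>. {x \<in> topspace X. q x \<in> K})" by auto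
    then show "openin X {x \<in> topspace X. q x \<in> \<Union>\<K>}" using K by auto
  qed blast+
  then show ?thesis
    unfolding quotient_topology_def by (simp add: topology_inverse')
qed

lemma topspace_quotient_topology: "topspace (quotient_topology X q) = q ` topspace X"
proof -
  have "{x \<in> topspace X. q x \<in> q ` topspace X} = topspace X" by auto
  then have "openin (quotient_topology X q) (q ` topspace X)"
    by (simp add: openin_quotient_topology)
  then show ?thesis
    by (metis openin_quotient_topology openin_subset openin_topspace subset_antisym)
qed

lemma quotient_map_quotient_topology: "quotient_map X (quotient_topology X q) q"
  by (auto simp: quotient_map_def topspace_quotient_topology openin_quotient_topology)

definition ordered_config_space :: "nat \<Rightarrow> 'a topology \<Rightarrow> (nat \<Rightarrow> 'a) topology" where
  "ordered_config_space k X =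
     subtopology (product_topology (\<lambda>_. X) {..<k}) {x. inj_on x {..<k}}"

definition perm_orbit :: "nat \<Rightarrow> (nat \<Rightarrow> 'a) \<Rightarrow> (nat \<Rightarrow> 'a) set" where
  "perm_orbit k x = {x \<circ> \<sigma> | \<sigma>. \<sigma> permutes {..<k}}"

definition unordered_config_space :: "nat \<Rightarrow> 'a topology \<Rightarrow> (nat \<Rightarrow> 'a) set topology" where
  "unordered_config_space k X = quotient_topology (ordered_config_space k X) (perm_orbit k)"

end

(*
The manifold M - U has an end: either a boundary point or a point of U in the closure of M - U.
Pushing inwards from that end gives a self-embedding e of X = M - U, isotopic to the identity
through injections, and a point p outside its image. Hence there are stabilisation maps
S : C_k(X) -> C_(k+1)(X), x |-> e(x) + p, and, lifting singular simplices to ordered configurations,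
transfer maps T : H(C_(k+1)(X)) -> H(C_k(X)) that sum over the ways to drop a point.
They satisfy T S = S T + id in homology, so by induction on k multiplication by a > 0 plus S T is
injective up to torsion; with a = 1 this is T S, so S is injective on rational homology.
*)

theory Submission
  imports Defs
begin

section \<open>Rational Betti numbers via integral cycles\<close>

text \<open>The obstacle is that \<open>U\<close> is an arbitrary closed set, so
  \<open>M - U\<close> need not have a collar near \<open>U\<close>. Instead, a point of
  \<open>M - U\<close> close to \<open>U\<close> has a nearest point of \<open>U\<close> in a chart;
  this gives a cone inside \<open>M - U\<close> with apex in \<open>U\<close>, and compressing the
  cone away from its apex makes room for a new point.

  Homotopy invariance, stabilisation and transfer are treated on integral chains. Injectivity over
  the rationals becomes the statement that every integral cycle in the kernel has a positive
  multiple that bounds. The general \<open>a\<close> is forced by the induction: if a z + S T z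
  bounds, applying T shows that (a + 1) w + S T w bounds for w = T z, which has one point fewer.

  The transfer needs simplices of unordered configurations to lift, uniquely up to one permutation.
  Uniqueness rests on Hausdorffness and on the connectedness of the simplex; existence is obtained
  by gluing local lifts over convex slabs of the simplex.\<close>

lemma (in linear_map) inj_dim_le:
  assumes inj: "inj_on T (carrier V)" and fin: "W.fin_dim"
  shows "V.fin_dim" "V.dim \<le> W.dim"
proof -
  \<comment> \<open>An injective map keeps independence, so no finite independent subset of
    \<open>V\<close> has more than \<open>W.dim\<close> elements. This bound also yields that
    \<open>V\<close> is finite-dimensional.\<close>
  have li: "W.module.lin_indpt (T ` A)" "card (T ` A) = card A" 
    if A: "finite A" "A \<subseteq> carrier V" "V.module.lin_indpt A" for A
  proof -
    show "card (T ` A) = card A"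
      using A inj by (meson card_image inj_on_subset)
    show "W.module.lin_indpt (T ` A)"
    proof (rule W.module.finite_lin_indpt2)
      show "finite (T ` A)" "T ` A \<subseteq> carrier W" using A by auto
      fix a assume a: "a \<in> T ` A \<rightarrow> carrier K" and 0: "W.module.lincomb a (T ` A) = \<zero>\<^bsub>W\<^esub>"
      have aT: "a \<circ> T \<in> A \<rightarrow> carrier K" using a by auto
      have "T (V.module.lincomb (a \<circ> T) A) = \<zero>\<^bsub>W\<^esub>"
        using lincomb_linear_image[OF inj A(2) a A(1)] 0 by simp
      then have lc: "V.module.lincomb (a \<circ> T) A = \<zero>\<^bsub>V\<^esub>"
        by (metis V.module.M.zero_closed V.module.lincomb_closed aT A(2) f0_is_0 inj inj_onD)
      have "(a \<circ> T) \<in> A \<rightarrow> {\<zero>\<^bsub>K\<^esub>}"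
        by (rule V.not_lindepD[OF A(3) A(1) subset_refl aT lc])
      then show "\<forall>v\<in>T ` A. a v = \<zero>\<^bsub>K\<^esub>" by auto
    qed
  qed
  have bound: "finite A \<and> card A \<le> W.dim"
    if "finite A \<and> A \<subseteq> carrier V \<and> V.module.lin_indpt A" for A
  proof -
    have "T ` A \<subseteq> carrier W" using that by auto
    from W.li_le_dim(2)[OF fin this] show ?thesis using li[of A] that by auto
  qed
  have "V.module.lin_indpt {}"
    by (auto simp: V.module.lin_dep_def)
  then obtain A where A: "finite A" "maximal A (\<lambda>A. finite A \<and> A \<subseteq> carrier V \<and> V.module.lin_indpt A)"
    using maximal_exists[of "\<lambda>A. finite A \<and> A \<subseteq> carrier V \<and> V.module.lin_indpt A" "W.dim" "{}"] bound
    by auto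
  \<comment> \<open>So far \<open>A\<close> is maximal only among finite independent sets. A larger
    independent set, finite or not, would already contain the larger finite one
    \<open>insert b A\<close>.\<close>
  have "maximal A (\<lambda>S. S \<subseteq> carrier V \<and> V.module.lin_indpt S)"
    unfolding maximal_def
  proof (intro conjI allI impI)
    show "A \<subseteq> carrier V" "V.module.lin_indpt A" using A by (auto simp: maximal_def)
    fix B assume B: "A \<subseteq> B \<and> B \<subseteq> carrier V \<and> V.module.lin_indpt B"
    show "B = A"
    proof (rule ccontr)
      assume "B \<noteq> A"
      then obtain b where b: "b \<in> B" "b \<notin> A" using B by auto
      have "V.module.lin_indpt (insert b A)"
        by (rule V.module.subset_li_is_li[of B]) (use B b in auto)
      then have "insert b A = A"
        using A B b unfolding maximal_def by blast
      then show False using b by auto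
    qed
  qed
  then have bas: "V.basis A" by (rule V.max_li_is_basis)
  then show "V.fin_dim" unfolding V.fin_dim_def V.basis_def using A by auto
  have "card A \<le> W.dim" using bound A by (auto simp: maximal_def)
  then show "V.dim \<le> W.dim" using V.dim_basis[OF A(1) bas] by simp
qed

section \<open>Comparison of integral and rational singular chains\<close>

definition rat_of_chain :: "'a chain \<Rightarrow> 'a rat_chain" where
  "rat_of_chain = Poly_Mapping.map of_int"

lemma lookup_rat_of_chain [simp]:
  "Poly_Mapping.lookup (rat_of_chain z) f = of_int (Poly_Mapping.lookup z f)"
  unfolding rat_of_chain_def by (simp add: Poly_Mapping.map.rep_eq when_def)

lemma rat_of_chain_simps:
  "rat_of_chain 0 = 0" "rat_of_chain (z + w) = rat_of_chain z + rat_of_chain w"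
  "rat_of_chain (z - w) = rat_of_chain z - rat_of_chain w"
  "rat_of_chain (frag_cmul a z) = rat_scale (of_int a) (rat_of_chain z)"
  "rat_of_chain (frag_of f) = Poly_Mapping.single f 1"
  by (rule poly_mapping_eqI; simp add: lookup_add lookup_minus lookup_single when_def)+

lemma rat_of_chain_sum: "rat_of_chain (\<Sum>x\<in>A. g x) = (\<Sum>x\<in>A. rat_of_chain (g x))"
  by (induction A rule: infinite_finite_induct) (auto simp: rat_of_chain_simps)

lemma rat_of_chain_inject: "rat_of_chain z = rat_of_chain w \<longleftrightarrow> z = w"
  by (metis lookup_rat_of_chain of_int_eq_iff poly_mapping_eqI)

lemma keys_rat_of_chain: "Poly_Mapping.keys (rat_of_chain z) = Poly_Mapping.keys z"
  by (auto simp: in_keys_iff)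

lemma rat_chains_rat_of_chain: "rat_of_chain z \<in> rat_chains p X \<longleftrightarrow> singular_chain p X z"
  by (simp add: rat_chains_def singular_chain_def keys_rat_of_chain)

text \<open>The support of a chain is finite, so the product of all denominators works. Facts on
  integral chains are carried over with it: scale, apply the integral fact, cancel the nonzero
  factor.\<close>

lemma rat_chain_clear_denominators:
  obtains N z where "(N::int) > 0" "rat_of_chain z = rat_scale (of_int N) c"
proof -
  define N where "N = (\<Prod>f\<in>Poly_Mapping.keys c. snd (quotient_of (Poly_Mapping.lookup c f)))"
  have N: "N > 0" unfolding N_def by (rule prod_pos) (auto intro: quotient_of_denom_pos')
  have "\<exists>m::int. of_int N * Poly_Mapping.lookup c f = of_int m" for f
  proof (cases "f \<in> Poly_Mapping.keys c")
    case True
    let ?q = "quotient_of (Poly_Mapping.lookup c f)"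
    define P where "P = (\<Prod>f\<in>Poly_Mapping.keys c - {f}. snd (quotient_of (Poly_Mapping.lookup c f)))"
    have N_eq: "N = P * snd ?q"
      unfolding N_def P_def using True by (simp add: prod.remove)
    have "of_int (snd ?q) * Poly_Mapping.lookup c f = of_int (fst ?q)"
      using quotient_of_div[of "Poly_Mapping.lookup c f" "fst ?q" "snd ?q"]
        quotient_of_denom_pos'[of "Poly_Mapping.lookup c f"]
      by (simp add: nonzero_eq_divide_eq mult.commute)
    then have "of_int N * Poly_Mapping.lookup c f = of_int (P * fst ?q)"
      by (simp only: N_eq of_int_mult mult.assoc)
    then show ?thesis by blast
  qed (auto simp: in_keys_iff intro: exI[of _ 0])
  then obtain m :: "_ \<Rightarrow> int" where m: "\<And>f. of_int N * Poly_Mapping.lookup c f = of_int (m f)" by metis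
  define z where "z = (\<Sum>f\<in>Poly_Mapping.keys c. frag_cmul (m f) (frag_of f))"
  have "m f = 0" if "f \<notin> Poly_Mapping.keys c" for f
    using m[of f] that by (simp add: in_keys_iff)
  then have "Poly_Mapping.lookup z f = m f" for f
    unfolding z_def by (auto simp: lookup_sum lookup_single when_def if_distrib sum.delta cong: if_cong)
  then have "rat_of_chain z = rat_scale (of_int N) c"
    by (intro poly_mapping_eqI) (simp add: m)
  with N that show ?thesis by blast
qed

definition rat_chain_map :: "nat \<Rightarrow> ('b \<Rightarrow> 'a) \<Rightarrow> 'b rat_chain \<Rightarrow> 'a rat_chain" where
  "rat_chain_map p s c =
     (\<Sum>f\<in>Poly_Mapping.keys c. Poly_Mapping.single (simplex_map p s f) (Poly_Mapping.lookup c f))"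

lemma rat_chain_map_superset:
  assumes "finite S" "Poly_Mapping.keys c \<subseteq> S"
  shows "rat_chain_map p s c = (\<Sum>f\<in>S. Poly_Mapping.single (simplex_map p s f) (Poly_Mapping.lookup c f))"
  unfolding rat_chain_map_def using assms
  by (auto intro!: sum.mono_neutral_left simp: in_keys_iff)

lemma rat_chain_map_add: "rat_chain_map p s (c + d) = rat_chain_map p s c + rat_chain_map p s d"
proof -
  let ?S = "Poly_Mapping.keys c \<union> Poly_Mapping.keys d"
  have "rat_chain_map p s e = (\<Sum>f\<in>?S. Poly_Mapping.single (simplex_map p s f) (Poly_Mapping.lookup e f))"
    if "Poly_Mapping.keys e \<subseteq> ?S" for e
    using that by (intro rat_chain_map_superset) auto
  then show ?thesis
    using Poly_Mapping.keys_add[of c d] by (simp add: lookup_add single_add sum.distrib)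
qed

lemma rat_chain_map_0 [simp]: "rat_chain_map p s 0 = 0"
  by (simp add: rat_chain_map_def)

lemma rat_chain_map_scale: "rat_chain_map p s (rat_scale q c) = rat_scale q (rat_chain_map p s c)"
  using rat_chain_map_superset[OF finite_keys keys_rat_scale, of p s q c]
  by (simp add: rat_chain_map_def rat_scale_sum rat_scale_single)

lemma rat_chain_map_diff: "rat_chain_map p s (c - d) = rat_chain_map p s c - rat_chain_map p s d"
  using rat_chain_map_add[of p s c "- d"] rat_chain_map_scale[of p s "-1" d] by (simp add: rat_scale_m1)

lemma rat_chain_map_rat_of_chain:
  "rat_chain_map p s (rat_of_chain z) = rat_of_chain (chain_map p s z)"
proof -
  have "Poly_Mapping.keys z \<subseteq> UNIV" by simp
  then show ?thesis
  proof (induction z rule: frag_induction)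
    case zero
    show ?case by (simp add: rat_of_chain_simps rat_chain_map_def)
  next
    case (one f)
    show ?case by (simp add: rat_of_chain_simps rat_chain_map_def)
  next
    case (diff a b)
    then show ?case by (simp add: rat_of_chain_simps chain_map_diff rat_chain_map_diff)
  qed
qed

lemma rat_boundary_rat_of_chain:
  "rat_boundary p (rat_of_chain z) = rat_of_chain (chain_boundary p z)"
proof -
  have "Poly_Mapping.keys z \<subseteq> UNIV" by simp
  then show ?thesis
  proof (induction z rule: frag_induction)
    case zero
    show ?case by (simp add: rat_of_chain_simps)
  next
    case (one f)
    show ?case
      by (simp add: rat_of_chain_simps rat_boundary_def chain_boundary_of rat_of_chain_sum rat_scale_single)
  next
    case (diff a b)
    have "rat_boundary p (rat_of_chain a - rat_of_chain b) = 
        rat_boundary p (rat_of_chain a) + rat_scale (-1) (rat_boundary p (rat_of_chain b))"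
      by (simp add: rat_scale_m1 flip: rat_boundary_add rat_boundary_scale)
    then show ?case using diff 
      by (simp add: rat_of_chain_simps chain_boundary_diff rat_scale_m1)
  qed
qed

lemma rat_scale_cancel: "q \<noteq> 0 \<Longrightarrow> rat_scale q c = rat_scale q d \<longleftrightarrow> c = d"
  by (metis rat_scale_1 rat_scale_scale left_inverse)

text \<open>An integral multiple of \<open>c\<close> is mapped to a chain of \<open>Y\<close> by the
  integral theory; dividing by the multiple again stays among the chains of
  \<open>Y\<close>.\<close>

lemma rat_chain_map_in_chains:
  assumes "continuous_map X Y s" "c \<in> rat_chains p X"
  shows "rat_chain_map p s c \<in> rat_chains p Y"
proof -
  obtain N z where N: "(N::int) > 0" "rat_of_chain z = rat_scale (of_int N) c"
    by (rule rat_chain_clear_denominators)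
  have "singular_chain p X z"
    using assms N(2) rat_chains_closed(3) by (metis rat_chains_rat_of_chain)
  then have "singular_chain p Y (chain_map p s z)"
    using assms(1) by (rule singular_chain_chain_map)
  then have "rat_scale (of_int N) (rat_chain_map p s c) \<in> rat_chains p Y"
    using N(2) by (metis rat_chains_rat_of_chain rat_chain_map_scale rat_chain_map_rat_of_chain)
  from rat_chains_closed(3)[OF this, of "inverse (of_int N)"] show ?thesis
    using N(1) by (simp add: rat_scale_scale)
qed

lemma rat_boundary_chain_map:
  assumes "c \<in> rat_chains p X"
  shows "rat_boundary p (rat_chain_map p s c) = rat_chain_map (p - 1) s (rat_boundary p c)"
proof -
  obtain N z where N: "(N::int) > 0" "rat_of_chain z = rat_scale (of_int N) c"
    by (rule rat_chain_clear_denominators)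
  have "singular_chain p X z"
    using assms N(2) rat_chains_closed(3) by (metis rat_chains_rat_of_chain)
  then have "chain_boundary p (chain_map p s z) = chain_map (p - 1) s (chain_boundary p z)"
    by (simp add: chain_boundary_chain_map)
  then have "rat_scale (of_int N) (rat_boundary p (rat_chain_map p s c)) =
      rat_scale (of_int N) (rat_chain_map (p - 1) s (rat_boundary p c))"
    by (metis N(2) rat_boundary_rat_of_chain rat_boundary_scale rat_chain_map_rat_of_chain rat_chain_map_scale)
  then show ?thesis using N(1) by (simp add: rat_scale_cancel)
qed

lemma rat_boundaries_uminus: "b \<in> rat_boundaries p X \<Longrightarrow> - b \<in> rat_boundaries p X"
  using rat_boundaries_closed(3)[of b p X "-1"] by (simp add: rat_scale_m1)

lemma rat_class_eq_iff: "rat_class p X c = rat_class p X d \<longleftrightarrow> c - d \<in> rat_boundaries p X"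
proof
  assume "rat_class p X c = rat_class p X d"
  then have "c \<in> rat_class p X d"
    using rat_boundaries_closed(1)[of p X] unfolding rat_class_def by (metis add.right_neutral imageI)
  then show "c - d \<in> rat_boundaries p X" by (auto simp: rat_class_def)
next
  have *: "rat_class p X c \<subseteq> rat_class p X d" if "c - d \<in> rat_boundaries p X" for c d
  proof
    fix x assume "x \<in> rat_class p X c"
    then obtain b where b: "b \<in> rat_boundaries p X" "x = d + ((c - d) + b)" by (auto simp: rat_class_def)
    then show "x \<in> rat_class p X d" 
      unfolding rat_class_def using rat_boundaries_closed(2)[OF that b(1)] by blast
  qed
  assume "c - d \<in> rat_boundaries p X"
  then show "rat_class p X c = rat_class p X d"
    using *[of c d] *[of d c] rat_boundaries_uminus by force
qed

text \<open>Torsion vanishes over the rationals, so a map whose kernel on integral homology is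
  torsion is injective on rational homology. If \<open>betti p Y\<close> is infinite, there is
  nothing to show.\<close>

theorem betti_le:
  assumes s: "continuous_map X Y s"
    and inj: "\<And>z. singular_relcycle p X {} z \<Longrightarrow> singular_relboundary p Y {} (chain_map p s z) \<Longrightarrow>
               \<exists>N>0. singular_relboundary p X {} (frag_cmul N z)"
  shows "betti p X \<le> betti p Y"
proof -
  \<comment> \<open>Classes are cosets; the image of a coset is thickened by the boundaries of
    \<open>Y\<close> so that it is a full coset again.\<close>
  define T where "T A = {rat_chain_map p s a + b | a b. a \<in> A \<and> b \<in> rat_boundaries p Y}" for A
  have bd: "rat_chain_map p s b \<in> rat_boundaries p Y" if b: "b \<in> rat_boundaries p X" for b
  proof -
    obtain d where d: "d \<in> rat_chains (Suc p) X" "b = rat_boundary (Suc p) d"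
      using b by (auto simp: rat_boundaries_def)
    then have "rat_chain_map p s b = rat_boundary (Suc p) (rat_chain_map (Suc p) s d)"
      using rat_boundary_chain_map[OF d(1), of s] by simp
    then show ?thesis using rat_chain_map_in_chains[OF s d(1)] by (auto simp: rat_boundaries_def)
  qed
  have cyc: "rat_chain_map p s c \<in> rat_cycles p Y" if "c \<in> rat_cycles p X" for c
    using that rat_chain_map_in_chains[OF s] rat_boundary_chain_map[of c p X s]
    by (simp add: rat_cycles_def)
  have T: "T (rat_class p X c) = rat_class p Y (rat_chain_map p s c)" for c
  proof
    show "T (rat_class p X c) \<subseteq> rat_class p Y (rat_chain_map p s c)"
    proof
      fix x assume "x \<in> T (rat_class p X c)"
      then obtain b b' where b: "b \<in> rat_boundaries p X" "b' \<in> rat_boundaries p Y"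
        "x = rat_chain_map p s c + (rat_chain_map p s b + b')"
        by (auto simp: T_def rat_class_def rat_chain_map_add add.assoc)
      from rat_boundaries_closed(2)[OF bd[OF b(1)] b(2)] show "x \<in> rat_class p Y (rat_chain_map p s c)"
        unfolding rat_class_def b(3) by (rule imageI)
    qed
    show "rat_class p Y (rat_chain_map p s c) \<subseteq> T (rat_class p X c)"
    proof
      fix x assume "x \<in> rat_class p Y (rat_chain_map p s c)"
      then obtain b where "b \<in> rat_boundaries p Y" "x = rat_chain_map p s (c + 0) + b"
        by (auto simp: rat_class_def)
      then show "x \<in> T (rat_class p X c)"
        unfolding T_def rat_class_def using rat_boundaries_closed(1)[of p X] by blast
    qed
  qed
  interpret V: vectorspace class_ring "rat_homology p X" by (rule vectorspace_rat_homology)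
  interpret W: vectorspace class_ring "rat_homology p Y" by (rule vectorspace_rat_homology)
  have "T \<in> module_hom class_ring (rat_homology p X) (rat_homology p Y)"
    unfolding module_hom_def
    by (auto simp: rat_homology_simps T rat_chain_map_add rat_chain_map_scale cyc)
  then interpret linear_map class_ring "rat_homology p X" "rat_homology p Y" T
    by unfold_locales 
  have "inj_on T (carrier (rat_homology p X))"
  proof (rule inj_onI)
    fix A B assume "A \<in> carrier (rat_homology p X)" "B \<in> carrier (rat_homology p X)" and TAB: "T A = T B"
    then obtain a b where ab: "A = rat_class p X a" "B = rat_class p X b"
        "a \<in> rat_cycles p X" "b \<in> rat_cycles p X" by (auto simp: rat_homology_simps)
    define c where "c = a - b"
    have c: "c \<in> rat_cycles p X" using rat_cycles_closed(2)[OF ab(3) rat_cycles_closed(3)[OF ab(4), of "-1"]]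
      by (simp add: c_def rat_scale_m1)
    have "rat_chain_map p s a - rat_chain_map p s b \<in> rat_boundaries p Y"
      using TAB by (simp add: ab T rat_class_eq_iff)
    then have "rat_chain_map p s c \<in> rat_boundaries p Y"
      by (simp add: c_def rat_chain_map_diff)
    then obtain d where d: "d \<in> rat_chains (Suc p) Y" "rat_chain_map p s c = rat_boundary (Suc p) d"
      by (auto simp: rat_boundaries_def)
    obtain N1 z1 where N1: "(N1::int) > 0" "rat_of_chain z1 = rat_scale (of_int N1) c"
      by (rule rat_chain_clear_denominators)
    obtain N2 z2 where N2: "(N2::int) > 0" "rat_of_chain z2 = rat_scale (of_int N2) d"
      by (rule rat_chain_clear_denominators)
    have ch: "singular_chain p X z1" "singular_chain (Suc p) Y z2"
      using N1 N2 c d by (auto simp: rat_cycles_def rat_chains_closed simp flip: rat_chains_rat_of_chain)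
    have "rat_of_chain (chain_boundary p z1) = rat_of_chain 0"
      using c by (simp add: N1 rat_boundary_scale rat_cycles_def rat_of_chain_simps(1) flip: rat_boundary_rat_of_chain)
    then have z1: "singular_relcycle p X {} z1"
      by (simp add: rat_of_chain_inject singular_cycle ch)
    \<comment> \<open>The denominators \<open>N1\<close> of \<open>c\<close> and \<open>N2\<close>
      of the bounding chain \<open>d\<close> differ. Cross-multiplying gives integral chains
      \<open>?z\<close> and \<open>?w\<close> such that the image of \<open>?z\<close> is the
      boundary of \<open>?w\<close>.\<close>
    let ?z = "frag_cmul N2 z1" and ?w = "frag_cmul N1 z2"
    have "rat_of_chain (chain_map p s ?z) = rat_of_chain (chain_boundary (Suc p) ?w)"
      by (simp add: N1 N2 d rat_chain_map_scale rat_boundary_scale rat_of_chain_simps rat_scale_scale mult.commute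
         flip: rat_chain_map_rat_of_chain rat_boundary_rat_of_chain)
    then have "chain_map p s ?z = chain_boundary (Suc p) ?w" by (simp only: rat_of_chain_inject)
    then have "singular_relboundary p Y {} (chain_map p s ?z)"
      unfolding singular_boundary using ch singular_chain_cmul by metis
    moreover have "singular_relcycle p X {} ?z" using z1 singular_relcycle_cmul by blast
    ultimately obtain N where N: "N > 0" "singular_relboundary p X {} (frag_cmul N ?z)"
      using inj by blast
    then obtain w where w: "singular_chain (Suc p) X w" "chain_boundary (Suc p) w = frag_cmul N ?z"
      by (auto simp: singular_boundary)
    have "rat_boundary (Suc p) (rat_of_chain w) = rat_scale (of_int (N * N2 * N1)) c"
      by (simp add: rat_boundary_rat_of_chain w rat_of_chain_simps N1 rat_scale_scale mult.assoc)
    moreover have "rat_boundary (Suc p) (rat_of_chain w) \<in> rat_boundaries p X"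
      using w(1) by (auto simp: rat_boundaries_def rat_chains_rat_of_chain)
    ultimately have "rat_scale (of_int (N * N2 * N1)) c \<in> rat_boundaries p X" by simp
    from rat_boundaries_closed(3)[OF this, of "inverse (of_int (N * N2 * N1))"]
    have "rat_scale (inverse (of_int (N * N2 * N1)) * of_int (N * N2 * N1)) c \<in> rat_boundaries p X"
      by (simp only: rat_scale_scale)
    moreover have "N * N2 * N1 \<noteq> 0" using N(1) N1(1) N2(1) by simp
    then have "inverse (of_int (N * N2 * N1)) * of_int (N * N2 * N1) = (1::rat)"
      by (intro left_inverse) (simp only: of_int_eq_0_iff not_False_eq_True)
    ultimately have "c \<in> rat_boundaries p X" by simp
    then show "A = B" by (simp add: ab rat_class_eq_iff c_def)
  qed
  from inj_dim_le[OF this] show ?thesis by (auto simp: betti_def)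
qed

section \<open>Configuration spaces and their local sections\<close>

lemma topspace_ordered_config_space:
  "topspace (ordered_config_space k X) = {x \<in> {..<k} \<rightarrow>\<^sub>E topspace X. inj_on x {..<k}}"
  by (auto simp: ordered_config_space_def)

lemma continuous_map_into_ordered_config_space:
  "continuous_map Z (ordered_config_space k X) f \<longleftrightarrow>
     (\<forall>i<k. continuous_map Z X (\<lambda>z. f z i)) \<and> f \<in> topspace Z \<rightarrow> extensional {..<k} \<and>
     (\<forall>z\<in>topspace Z. inj_on (f z) {..<k})"
  unfolding ordered_config_space_def continuous_map_in_subtopology continuous_map_componentwise
  by (auto simp: Pi_iff)

lemma continuous_map_config_coordinate:
  "i < k \<Longrightarrow> continuous_map (ordered_config_space k X) X (\<lambda>x. x i)"
  unfolding ordered_config_space_def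
  by (intro continuous_map_from_subtopology continuous_map_product_projection) auto

lemma Hausdorff_ordered_config_space:
  "Hausdorff_space X \<Longrightarrow> Hausdorff_space (ordered_config_space k X)"
  by (simp add: ordered_config_space_def Hausdorff_space_product_topology Hausdorff_space_subtopology)

lemma permutes_compose_config:
  assumes "x \<in> topspace (ordered_config_space k X)" "\<sigma> permutes {..<k}"
  shows "x \<circ> \<sigma> \<in> topspace (ordered_config_space k X)"
proof -
  have "inj_on (x \<circ> \<sigma>) {..<k}"
    using assms by (intro comp_inj_on) (simp_all add: topspace_ordered_config_space permutes_image permutes_inj_on)
  moreover have "x \<circ> \<sigma> \<in> {..<k} \<rightarrow>\<^sub>E topspace X"
    using assms permutes_in_image[OF assms(2)] permutes_not_in[OF assms(2)]
    by (auto simp: topspace_ordered_config_space PiE_iff extensional_def)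
  ultimately show ?thesis by (simp add: topspace_ordered_config_space)
qed

lemma continuous_map_permute_config:
  assumes "\<sigma> permutes {..<k}"
  shows "continuous_map (ordered_config_space k X) (ordered_config_space k X) (\<lambda>x. x \<circ> \<sigma>)"
  unfolding continuous_map_into_ordered_config_space
proof (intro conjI allI impI ballI)
  fix i assume "i < k"
  then have "\<sigma> i < k" using permutes_in_image[OF assms, of i] by simp
  then show "continuous_map (ordered_config_space k X) X (\<lambda>x. (x \<circ> \<sigma>) i)"
    using continuous_map_config_coordinate by simp
qed (use permutes_compose_config[OF _ assms, of _ X] in \<open>auto simp: topspace_ordered_config_space PiE_iff\<close>)

lemma perm_orbit_self: "x \<in> perm_orbit k x"
  unfolding perm_orbit_def by (rule CollectI, rule exI[of _ id]) (simp add: permutes_id)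

lemma perm_orbit_compose:
  assumes "\<sigma> permutes {..<k}"
  shows "perm_orbit k (x \<circ> \<sigma>) = perm_orbit k x"
proof -
  have *: "perm_orbit k (x \<circ> \<sigma>) \<subseteq> perm_orbit k x" if "\<sigma> permutes {..<k}" for x :: "nat \<Rightarrow> 'a" and \<sigma>
    using permutes_compose[OF _ that] by (auto simp: perm_orbit_def comp_assoc)
  have "x = x \<circ> \<sigma> \<circ> inv_into UNIV \<sigma>"
    using assms by (simp add: comp_assoc permutes_inv_o)
  then show ?thesis
    using *[OF assms, of x] *[OF permutes_inv[OF assms], of "x \<circ> \<sigma>"] by auto
qed

lemma perm_orbit_eq_iff:
  "perm_orbit k x = perm_orbit k y \<longleftrightarrow> (\<exists>\<sigma>. \<sigma> permutes {..<k} \<and> x = y \<circ> \<sigma>)"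
proof
  assume "perm_orbit k x = perm_orbit k y"
  then have "x \<in> perm_orbit k y" using perm_orbit_self by metis
  then show "\<exists>\<sigma>. \<sigma> permutes {..<k} \<and> x = y \<circ> \<sigma>" by (auto simp: perm_orbit_def)
qed (auto simp: perm_orbit_compose)

text \<open>An unordered configuration is determined by its set of points. Identities between maps
  of unordered configurations are checked below as equations of finite sets by means of
  this.\<close>

lemma perm_orbit_eq_iff_image:
  assumes x: "x \<in> topspace (ordered_config_space k X)" and y: "y \<in> topspace (ordered_config_space k Y)"
  shows "perm_orbit k x = perm_orbit k y \<longleftrightarrow> x ` {..<k} = y ` {..<k}"
proof
  assume "perm_orbit k x = perm_orbit k y"
  then obtain \<sigma> where "\<sigma> permutes {..<k}" "x = y \<circ> \<sigma>" by (auto simp: perm_orbit_eq_iff)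
  then show "x ` {..<k} = y ` {..<k}" by (simp only: image_comp[symmetric] permutes_image)
next
  assume eq: "x ` {..<k} = y ` {..<k}"
  have injx: "inj_on x {..<k}" and injy: "inj_on y {..<k}"
    using x y by (auto simp: topspace_ordered_config_space)
  define \<sigma> where "\<sigma> i = (if i < k then inv_into {..<k} y (x i) else i)" for i
  have y\<sigma>: "y (\<sigma> i) = x i" if "i < k" for i
  proof -
    have "x i \<in> y ` {..<k}" using that eq by auto
    then show ?thesis using that by (simp add: \<sigma>_def f_inv_into_f)
  qed
  have "x = y \<circ> \<sigma>"
  proof
    fix i show "x i = (y \<circ> \<sigma>) i"
      using x y y\<sigma> by (cases "i < k") (auto simp: \<sigma>_def topspace_ordered_config_space PiE_iff extensional_def)
  qed
  moreover have "\<sigma> permutes {..<k}"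
  proof (rule bij_imp_permutes)
    have "bij_betw (inv_into {..<k} y \<circ> x) {..<k} {..<k}"
      by (rule bij_betw_trans[of x _ "x ` {..<k}"])
         (use injx injy in \<open>auto simp: eq bij_betw_imageI intro!: bij_betw_inv_into\<close>)
    then show "bij_betw \<sigma> {..<k} {..<k}"
      by (rule bij_betw_cong[THEN iffD1, rotated]) (auto simp: \<sigma>_def)
  qed (auto simp: \<sigma>_def)
  ultimately show "perm_orbit k x = perm_orbit k y" by (auto simp: perm_orbit_eq_iff)
qed

lemma topspace_unordered_config_space:
  "topspace (unordered_config_space k X) = perm_orbit k ` topspace (ordered_config_space k X)"
  by (simp add: unordered_config_space_def topspace_quotient_topology)

lemma quotient_map_perm_orbit:
  "quotient_map (ordered_config_space k X) (unordered_config_space k X) (perm_orbit k)"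
  by (simp add: unordered_config_space_def quotient_map_quotient_topology)

lemma continuous_map_perm_orbit:
  "continuous_map (ordered_config_space k X) (unordered_config_space k X) (perm_orbit k)"
  by (simp add: quotient_map_perm_orbit quotient_imp_continuous_map)

text \<open>The saturation of an open set is the union of its translates by permutations, each of
  which is open.\<close>

lemma open_map_perm_orbit:
  "open_map (ordered_config_space k X) (unordered_config_space k X) (perm_orbit k)"
  unfolding open_map_def
proof (intro allI impI)
  fix U assume U: "openin (ordered_config_space k X) U"
  let ?F = "ordered_config_space k X"
  have "{x \<in> topspace ?F. perm_orbit k x \<in> perm_orbit k ` U} =
      (\<Union>\<sigma>\<in>{\<sigma>. \<sigma> permutes {..<k}}. {x \<in> topspace ?F. x \<circ> \<sigma> \<in> U})" (is "?L = ?R")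
  proof
    show "?L \<subseteq> ?R"
      using openin_subset[OF U] by (auto simp: image_iff) (metis perm_orbit_eq_iff)
    show "?R \<subseteq> ?L"
    proof
      fix x assume "x \<in> ?R"
      then obtain \<sigma> where "\<sigma> permutes {..<k}" "x \<in> topspace ?F" "x \<circ> \<sigma> \<in> U" by auto
      then show "x \<in> ?L" using perm_orbit_compose[of \<sigma> k x] by (metis (mono_tags) image_eqI mem_Collect_eq)
    qed
  qed
  moreover have "openin ?F {x \<in> topspace ?F. x \<circ> \<sigma> \<in> U}" if "\<sigma> permutes {..<k}" for \<sigma>
    using openin_continuous_map_preimage[OF continuous_map_permute_config[OF that] U] .
  ultimately have "openin ?F {x \<in> topspace ?F. perm_orbit k x \<in> perm_orbit k ` U}" by auto
  then show "openin (unordered_config_space k X) (perm_orbit k ` U)"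
    using openin_subset[OF U]
    by (auto simp: unordered_config_space_def openin_quotient_topology)
qed

text \<open>For each permutation, the set where \<open>g\<close> is \<open>h\<close> composed with
  it is closed by Hausdorffness. These sets are finitely many, cover \<open>Z\<close>, and are
  disjoint because the points of a configuration are distinct. So the one through \<open>z0\<close>
  is clopen and is all of \<open>Z\<close>.\<close>

lemma config_lift_unique:
  assumes X: "Hausdorff_space X" and Z: "connected_space Z"
    and g: "continuous_map Z (ordered_config_space k X) g"
    and h: "continuous_map Z (ordered_config_space k X) h"
    and eq: "\<And>z. z \<in> topspace Z \<Longrightarrow> perm_orbit k (g z) = perm_orbit k (h z)"
  obtains \<sigma> where "\<sigma> permutes {..<k}" "\<And>z. z \<in> topspace Z \<Longrightarrow> g z = h z \<circ> \<sigma>"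
proof (cases "topspace Z = {}")
  case True
  then show ?thesis using that[OF permutes_id] by simp
next
  case False
  then obtain z0 where z0: "z0 \<in> topspace Z" by blast
  define A where "A \<sigma> = {z \<in> topspace Z. g z = h z \<circ> \<sigma>}" for \<sigma>
  define S where "S = {\<sigma>. \<sigma> permutes {..<k}}"
  have fin: "finite S" by (simp add: S_def finite_permutations)
  have clo: "closedin Z (A \<sigma>)" if "\<sigma> \<in> S" for \<sigma>
    unfolding A_def
  proof (rule closedin_continuous_maps_eq)
    show "Hausdorff_space (ordered_config_space k X)" using X by (rule Hausdorff_ordered_config_space)
    show "continuous_map Z (ordered_config_space k X) (\<lambda>z. h z \<circ> \<sigma>)"
      using continuous_map_compose[OF h continuous_map_permute_config[of \<sigma> k X]] that
      by (simp add: S_def o_def)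
  qed (rule g)
  have cover: "(\<Union>\<sigma>\<in>S. A \<sigma>) = topspace Z"
    using eq by (auto simp: A_def S_def perm_orbit_eq_iff)
  obtain \<sigma> where \<sigma>: "\<sigma> \<in> S" "z0 \<in> A \<sigma>" using z0 cover by auto
  have disj: "A \<sigma> \<inter> A \<tau> = {}" if "\<tau> \<in> S" "\<tau> \<noteq> \<sigma>" for \<tau>
  proof (rule ccontr)
    assume "A \<sigma> \<inter> A \<tau> \<noteq> {}"
    then obtain z where "z \<in> A \<sigma>" "z \<in> A \<tau>" by blast
    then have z: "z \<in> topspace Z" "h z \<circ> \<sigma> = h z \<circ> \<tau>" by (simp_all add: A_def)
    have "inj_on (h z) {..<k}"
      using h z(1) by (simp add: continuous_map_into_ordered_config_space)
    have "\<sigma> i = \<tau> i" for i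
    proof (cases "i < k")
      case True
      have "\<sigma> i < k" "\<tau> i < k"
        using True that \<sigma> permutes_in_image[of \<sigma> "{..<k}" i] permutes_in_image[of \<tau> "{..<k}" i]
        by (auto simp: S_def)
      then show ?thesis using \<open>inj_on (h z) {..<k}\<close> fun_cong[OF z(2), of i] by (auto dest: inj_onD)
    next
      case False
      then show ?thesis using that \<sigma> permutes_not_in[of \<sigma> "{..<k}" i] permutes_not_in[of \<tau> "{..<k}" i]
        by (auto simp: S_def)
    qed
    then show False using that(2) by auto
  qed
  have "A \<sigma> = topspace Z - (\<Union>\<tau>\<in>S - {\<sigma>}. A \<tau>)"
    using disj cover \<sigma> unfolding A_def by blast
  moreover have "closedin Z (\<Union>\<tau>\<in>S - {\<sigma>}. A \<tau>)"
    using fin clo by (intro closedin_Union) auto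
  ultimately have "openin Z (A \<sigma>)" by auto
  then have "A \<sigma> = topspace Z"
    using Z clo[OF \<sigma>(1)] \<sigma>(2) unfolding connected_space_clopen_in by auto
  then show ?thesis using that[of \<sigma>] \<sigma>(1) by (auto simp: A_def S_def)
qed

lemma Hausdorff_space_disjoint_family:
  assumes X: "Hausdorff_space X" and I: "finite I" and y: "y ` I \<subseteq> topspace X" "inj_on y I"
  obtains V where "\<And>i. i \<in> I \<Longrightarrow> openin X (V i)" "\<And>i. i \<in> I \<Longrightarrow> y i \<in> V i"
    "\<And>i j. i \<in> I \<Longrightarrow> j \<in> I \<Longrightarrow> i \<noteq> j \<Longrightarrow> V i \<inter> V j = {}"
proof -
  have "\<exists>A B. openin X A \<and> openin X B \<and> y i \<in> A \<and> y j \<in> B \<and> A \<inter> B = {}"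
    if "i \<in> I" "j \<in> I" "i \<noteq> j" for i j
  proof -
    have "y i \<noteq> y j" "y i \<in> topspace X" "y j \<in> topspace X" using y that by (auto dest: inj_onD)
    then show ?thesis using X unfolding Hausdorff_space_def by (metis disjnt_def)
  qed
  then obtain A B where AB: "\<And>i j. i \<in> I \<Longrightarrow> j \<in> I \<Longrightarrow> i \<noteq> j \<Longrightarrow>
      openin X (A i j) \<and> openin X (B i j) \<and> y i \<in> A i j \<and> y j \<in> B i j \<and> A i j \<inter> B i j = {}"
    by metis
  define V where "V i = topspace X \<inter> (\<Inter>j\<in>I - {i}. A i j \<inter> B j i)" for i
  show ?thesis
  proof
    show "openin X (V i)" if i: "i \<in> I" for i
    proof (cases "I - {i} = {}")
      case True
      show ?thesis unfolding V_def True by simp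
    next
      case False
      show ?thesis
        unfolding V_def
        by (intro openin_Int openin_topspace openin_INT2 False) (use I i AB in auto)
    qed
    show "y i \<in> V i" if "i \<in> I" for i
      unfolding V_def using that AB y by auto
    show "V i \<inter> V j = {}" if "i \<in> I" "j \<in> I" "i \<noteq> j" for i j
    proof -
      have "V i \<subseteq> A i j" "V j \<subseteq> B i j" unfolding V_def using that by auto
      then show ?thesis using AB[OF that] by auto
    qed
  qed
qed

text \<open>Disjoint neighbourhoods \<open>V i\<close> of the points of a representative turn labels
  into positions: on the box \<open>B\<close> of these neighbourhoods the orbit map is injective,
  and being continuous and open it is a homeomorphism onto its image.\<close>

lemma config_local_section:
  assumes X: "Hausdorff_space X" and c: "c \<in> topspace (unordered_config_space k X)"
  obtains W s where "openin (unordered_config_space k X) W" "c \<in> W"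
    "continuous_map (subtopology (unordered_config_space k X) W) (ordered_config_space k X) s"
    "\<And>w. w \<in> W \<Longrightarrow> perm_orbit k (s w) = w"
proof -
  let ?F = "ordered_config_space k X" and ?C = "unordered_config_space k X"
  obtain y where y: "y \<in> topspace ?F" "c = perm_orbit k y"
    using c by (auto simp: topspace_unordered_config_space)
  have y': "y ` {..<k} \<subseteq> topspace X" "inj_on y {..<k}"
    using y(1) by (auto simp: topspace_ordered_config_space)
  obtain V where V: "\<And>i. i < k \<Longrightarrow> openin X (V i)" "\<And>i. i < k \<Longrightarrow> y i \<in> V i"
      "\<And>i j. i < k \<Longrightarrow> j < k \<Longrightarrow> i \<noteq> j \<Longrightarrow> V i \<inter> V j = {}"
    using Hausdorff_space_disjoint_family[OF X finite_lessThan y'] by (metis lessThan_iff)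
  define B where "B = {x \<in> topspace ?F. \<forall>i\<in>{..<k}. x i \<in> V i}"
  have B: "openin ?F B"
    unfolding B_def
  proof (cases "k = 0")
    case False
    have "{x \<in> topspace ?F. \<forall>i\<in>{..<k}. x i \<in> V i} = (\<Inter>i\<in>{..<k}. {x \<in> topspace ?F. x i \<in> V i})"
      using False by auto
    also have "openin ?F \<dots>"
      using False V(1) by (intro openin_INT2 openin_continuous_map_preimage[OF continuous_map_config_coordinate]) auto
    finally show "openin ?F {x \<in> topspace ?F. \<forall>i\<in>{..<k}. x i \<in> V i}" .
  qed auto
  have inj: "inj_on (perm_orbit k) B"
  proof (rule inj_onI)
    fix x z assume xz: "x \<in> B" "z \<in> B" "perm_orbit k x = perm_orbit k z"
    then obtain \<sigma> where \<sigma>: "\<sigma> permutes {..<k}" "x = z \<circ> \<sigma>" by (auto simp: perm_orbit_eq_iff)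
    have "x i = z i" for i
    proof (cases "i < k")
      case True
      then have "\<sigma> i < k" using permutes_in_image[OF \<sigma>(1), of i] by simp
      then have "z (\<sigma> i) \<in> V i \<inter> V (\<sigma> i)" using xz True \<sigma>(2) by (auto simp: B_def)
      then have "\<sigma> i = i" using V(3)[OF True \<open>\<sigma> i < k\<close>] by fastforce
      then show ?thesis using \<sigma> by simp
    qed (use \<sigma> permutes_not_in[OF \<sigma>(1), of i] in auto)
    then show "x = z" by auto
  qed
  define W where "W = perm_orbit k ` B"
  have W: "openin ?C W" using B open_map_perm_orbit unfolding open_map_def W_def by blast
  have BF: "B \<subseteq> topspace ?F" by (auto simp: B_def)
  have WC: "W \<subseteq> topspace ?C" using W openin_subset by blast
  have "homeomorphic_map (subtopology ?F B) (subtopology ?C W) (perm_orbit k)"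
  proof (rule bijective_open_imp_homeomorphic_map)
    show "continuous_map (subtopology ?F B) (subtopology ?C W) (perm_orbit k)"
      by (auto simp: continuous_map_in_subtopology W_def continuous_map_perm_orbit continuous_map_from_subtopology)
    show "open_map (subtopology ?F B) (subtopology ?C W) (perm_orbit k)"
      unfolding open_map_def openin_open_subtopology[OF B] openin_open_subtopology[OF W]
      using open_map_perm_orbit unfolding open_map_def W_def by blast
    show "perm_orbit k ` topspace (subtopology ?F B) = topspace (subtopology ?C W)"
      using BF WC by (simp add: inf.absorb2 W_def)
    show "inj_on (perm_orbit k) (topspace (subtopology ?F B))"
      using inj BF by (simp add: inf.absorb2)
  qed
  then obtain s where s: "homeomorphic_maps (subtopology ?F B) (subtopology ?C W) (perm_orbit k) s"
    using homeomorphic_map_maps by blast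
  show ?thesis
  proof
    show "openin ?C W" by (rule W)
    show "c \<in> W" using y V(2) by (auto simp: W_def B_def)
    show "continuous_map (subtopology ?C W) ?F s"
      using s unfolding homeomorphic_maps_def continuous_map_in_subtopology by blast
    show "perm_orbit k (s w) = w" if "w \<in> W" for w
      using s that WC by (auto simp: homeomorphic_maps_def)
  qed
qed

text \<open>A product neighbourhood of \<open>y\<close> leaves a positive radius in each coordinate;
  only the finitely many coordinates in \<open>I\<close> vary, so the least of their radii works for
  all.\<close>

lemma open_contains_coordinate_box:
  fixes y :: "nat \<Rightarrow> real"
  assumes "open O'" "y \<in> O'" "finite I"
  obtains \<delta> where "\<delta> > 0" "\<And>x. (\<And>i. i \<in> I \<Longrightarrow> \<bar>x i - y i\<bar> \<le> \<delta>) \<Longrightarrow> (\<And>i. i \<notin> I \<Longrightarrow> x i = y i) \<Longrightarrow> x \<in> O'"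
proof -
  have "openin (powertop_real UNIV) O'" using assms(1) by (simp add: euclidean_product_topology)
  then obtain U where U: "\<And>i. open (U i)" "y \<in> Pi\<^sub>E UNIV U" "Pi\<^sub>E UNIV U \<subseteq> O'"
    using assms(2) unfolding openin_product_topology_alt by (metis UNIV_I open_openin)
  have "\<exists>d>0. cball (y i) d \<subseteq> U i" for i
    using U(1,2) open_contains_cball by (metis PiE_iff UNIV_I)
  then obtain d where d: "\<And>i. d i > 0" "\<And>i. cball (y i) (d i) \<subseteq> U i" by metis
  define \<delta> where "\<delta> = Min (insert 1 (d ` I))"
  have \<delta>: "\<delta> > 0" "\<And>i. i \<in> I \<Longrightarrow> \<delta> \<le> d i"
    using assms(3) d(1) by (auto simp: \<delta>_def)
  show ?thesis
  proof
    fix x assume x: "\<And>i. i \<in> I \<Longrightarrow> \<bar>x i - y i\<bar> \<le> \<delta>" "\<And>i. i \<notin> I \<Longrightarrow> x i = y i"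
    have "x i \<in> cball (y i) (d i)" for i
    proof (cases "i \<in> I")
      case True
      with x(1)[OF this] \<delta>(2)[OF this] show ?thesis by (auto simp: dist_real_def)
    qed (use x(2)[of i] d(1)[of i] in \<open>auto simp: less_imp_le\<close>)
    then have "x i \<in> U i" for i using d(2) by blast
    then have "x \<in> Pi\<^sub>E UNIV U" by (simp add: PiE_iff)
    then show "x \<in> O'" using U(3) by auto
  qed (rule \<delta>(1))
qed

lemma connected_if_segments:
  fixes S :: "(nat \<Rightarrow> real) set"
  assumes "\<And>x y t. x \<in> S \<Longrightarrow> y \<in> S \<Longrightarrow> 0 \<le> t \<Longrightarrow> t \<le> 1 \<Longrightarrow> (\<lambda>i. (1 - t) * x i + t * y i) \<in> S"
  shows "connected S"
proof (rule path_connected_imp_connected)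
  show "path_connected S"
    unfolding path_connected_def
  proof (intro ballI)
    fix x y assume xy: "x \<in> S" "y \<in> S"
    let ?g = "\<lambda>t i. (1 - t) * x i + t * y i"
    have "path ?g"
      unfolding path_def by (intro continuous_on_coordinatewise_then_product continuous_intros)
    moreover have "path_image ?g \<subseteq> S" using assms xy by (auto simp: path_image_def)
    ultimately show "\<exists>g. path g \<and> path_image g \<subseteq> S \<and> pathstart g = x \<and> pathfinish g = y"
      by (intro exI[of _ ?g]) (auto simp: pathstart_def pathfinish_def)
  qed
qed

section \<open>Gluing of partial lifts\<close>

definition config_liftable ::
  "nat \<Rightarrow> 'a topology \<Rightarrow> ('b::topological_space \<Rightarrow> (nat \<Rightarrow> 'a) set) \<Rightarrow> 'b set \<Rightarrow> bool" where
  "config_liftable k X f K \<longleftrightarrow>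
     (\<exists>g. continuous_map (top_of_set K) (ordered_config_space k X) g \<and> (\<forall>x\<in>K. perm_orbit k (g x) = f x))"

lemma config_liftable_subset: "config_liftable k X f K \<Longrightarrow> L \<subseteq> K \<Longrightarrow> config_liftable k X f L"
  unfolding config_liftable_def by (meson continuous_map_from_subtopology_mono subset_iff)

text \<open>On the connected overlap the two lifts differ by one fixed permutation. Correcting
  \<open>h\<close> by it makes them agree there, and they can be pasted along closed sets. The
  overlap may be empty.\<close>

lemma config_liftable_Un:
  assumes X: "Hausdorff_space X" and KL: "closed K" "closed L" "connected (K \<inter> L)"
    and lift: "config_liftable k X f K" "config_liftable k X f L"
  shows "config_liftable k X f (K \<union> L)"
proof -
  let ?F = "ordered_config_space k X"
  obtain g where g: "continuous_map (top_of_set K) ?F g" "\<And>x. x \<in> K \<Longrightarrow> perm_orbit k (g x) = f x"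
    using lift by (auto simp: config_liftable_def)
  obtain h where h: "continuous_map (top_of_set L) ?F h" "\<And>x. x \<in> L \<Longrightarrow> perm_orbit k (h x) = f x"
    using lift by (auto simp: config_liftable_def)
  have "connected_space (top_of_set (K \<inter> L))" using KL(3) by (simp add: connectedin_def flip: connectedin_iff_connected)
  moreover have "continuous_map (top_of_set (K \<inter> L)) ?F g" "continuous_map (top_of_set (K \<inter> L)) ?F h"
    using g(1) h(1) by (auto intro: continuous_map_from_subtopology_mono)
  ultimately obtain \<sigma> where \<sigma>: "\<sigma> permutes {..<k}" "\<And>x. x \<in> K \<inter> L \<Longrightarrow> g x = h x \<circ> \<sigma>"
    using config_lift_unique[OF X, of "top_of_set (K \<inter> L)" k g h] g(2) h(2) by auto
  define G where "G = (\<lambda>x. if x \<in> K then g x else h x \<circ> \<sigma>)"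
  define T where "T b = (if b then K else L)" for b :: bool
  define \<phi> where "\<phi> b = (if b then g else (\<lambda>x. h x \<circ> \<sigma>))" for b :: bool
  have "continuous_map (top_of_set (K \<union> L)) ?F G"
  proof (rule pasting_lemma_closed[where I = UNIV and T = T and f = \<phi>])
    show "closedin (top_of_set (K \<union> L)) (T i)" for i
      using KL by (auto simp: T_def intro: closed_subset)
    have "continuous_map (top_of_set L) ?F (\<lambda>x. h x \<circ> \<sigma>)"
      using continuous_map_compose[OF h(1) continuous_map_permute_config[OF \<sigma>(1)]] by (simp add: o_def)
    then show "continuous_map (subtopology (top_of_set (K \<union> L)) (T i)) ?F (\<phi> i)" for i
      using g(1) by (auto simp: T_def \<phi>_def subtopology_subtopology Int_absorb1)
    show "\<phi> i x = \<phi> j x" if "x \<in> topspace (top_of_set (K \<union> L)) \<inter> T i \<inter> T j" for i j x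
      using that \<sigma>(2)[of x] by (cases i; cases j) (auto simp: T_def \<phi>_def)
    show "\<exists>j. j \<in> UNIV \<and> x \<in> T j \<and> G x = \<phi> j x" if "x \<in> topspace (top_of_set (K \<union> L))" for x
      using that by (intro exI[of _ "x \<in> K"]) (auto simp: T_def \<phi>_def G_def)
  qed auto
  moreover have "perm_orbit k (G x) = f x" if "x \<in> K \<union> L" for x
    using that g(2)[of x] h(2)[of x] perm_orbit_compose[OF \<sigma>(1), of "h x"] unfolding G_def
    by (metis UnE)
  ultimately show ?thesis unfolding config_liftable_def by blast
qed

section \<open>Lifting singular simplices to ordered configurations\<close>

lemma config_liftable_locally:
  assumes X: "Hausdorff_space X"
    and f: "continuous_map (top_of_set S) (unordered_config_space k X) f" and y: "y \<in> S"
  obtains O' where "open O'" "y \<in> O'" "config_liftable k X f (S \<inter> O')"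
proof -
  let ?C = "unordered_config_space k X"
  have "f y \<in> topspace ?C" using f y by (auto simp: continuous_map_def)
  from config_local_section[OF X this] obtain W s where W: "openin ?C W" "f y \<in> W"
      and s: "continuous_map (subtopology ?C W) (ordered_config_space k X) s" 
      and qs: "\<And>w. w \<in> W \<Longrightarrow> perm_orbit k (s w) = w" by blast
  have "openin (top_of_set S) {x \<in> S. f x \<in> W}"
    using openin_continuous_map_preimage[OF f W(1)] by simp
  then obtain O' where O': "open O'" "{x \<in> S. f x \<in> W} = S \<inter> O'"
    by (auto simp: openin_open)
  have "continuous_map (top_of_set (S \<inter> O')) (subtopology ?C W) f"
    using f O'(2) by (auto simp: continuous_map_in_subtopology intro: continuous_map_from_subtopology_mono)
  then have "continuous_map (top_of_set (S \<inter> O')) (ordered_config_space k X) (s \<circ> f)"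
    using s by (rule continuous_map_compose)
  then have "config_liftable k X f (S \<inter> O')"
    unfolding config_liftable_def using qs O'(2) by (intro exI[of _ "s \<circ> f"]) auto
  then show ?thesis using that O' W(2) y by blast
qed

lemma closed_standard_simplex: "closed (standard_simplex p)"
  using closedin_standard_simplex[of p] by (simp add: euclidean_product_topology)

text \<open>Lifts are glued one coordinate at a time. On \<open>D m y \<delta>\<close> the
  coordinates from \<open>m\<close> to \<open>p\<close> stay within \<open>\<delta>\<close> of
  \<open>y\<close>, and those below \<open>m\<close> are free. For \<open>m = 0\<close> a local lift
  suffices; each step frees one more coordinate by bisecting its range from 0 to 1; at
  \<open>m = Suc p\<close> the set is the whole simplex.\<close>

lemma config_liftable_standard_simplex:
  assumes X: "Hausdorff_space X"
    and f: "continuous_map (top_of_set (standard_simplex p)) (unordered_config_space k X) f"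
  shows "config_liftable k X f (standard_simplex p)"
proof -
  let ?S = "standard_simplex p"
  define D where "D m y \<delta> = {x \<in> ?S. \<forall>i. m \<le> i \<and> i \<le> p \<longrightarrow> \<bar>x i - y i\<bar> \<le> \<delta>}" 
    for m and y :: "nat \<Rightarrow> real" and \<delta>
  have "\<exists>\<delta>>0. config_liftable k X f (D m y \<delta>)" if "m \<le> Suc p" for m y
    using that
  proof (induction m arbitrary: y)
    case 0
    \<comment> \<open>Points of the simplex vanish beyond \<open>p\<close>, so the centre is altered
      to do the same; then \<open>D 0 y \<delta>\<close> fits into a neighbourhood of
      \<open>y'\<close>. If \<open>y'\<close> is off the simplex, the complement of the simplex
      serves as the neighbourhood and the lift is vacuous.\<close>
    define y' where "y' i = (if i \<le> p then y i else 0)" for i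
    have "\<exists>O'. open O' \<and> y' \<in> O' \<and> config_liftable k X f (?S \<inter> O')"
    proof (cases "y' \<in> ?S")
      case True
      then show ?thesis using config_liftable_locally[OF X f True] by blast
    next
      case False
      have "config_liftable k X f (?S \<inter> - ?S)"
        by (auto simp: config_liftable_def)
      then show ?thesis using False closed_standard_simplex open_Compl by blast
    qed
    then obtain O' where O': "open O'" "y' \<in> O'" "config_liftable k X f (?S \<inter> O')" by blast
    obtain \<delta> where \<delta>: "\<delta> > 0" "\<And>x. (\<And>i. i \<in> {..p} \<Longrightarrow> \<bar>x i - y' i\<bar> \<le> \<delta>) \<Longrightarrow> 
        (\<And>i. i \<notin> {..p} \<Longrightarrow> x i = y' i) \<Longrightarrow> x \<in> O'"
      using open_contains_coordinate_box[OF O'(1,2) finite_atMost, of p] by metis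
    have "D 0 y \<delta> \<subseteq> ?S \<inter> O'"
    proof
      fix x assume x: "x \<in> D 0 y \<delta>"
      then have "x i = 0" if "i > p" for i
        using that by (auto simp: D_def standard_simplex_def)
      with x have "x \<in> O'" by (intro \<delta>(2)) (auto simp: D_def y'_def)
      then show "x \<in> ?S \<inter> O'" using x by (auto simp: D_def)
    qed
    then show ?case using \<delta>(1) config_liftable_subset[OF O'(3)] by blast
  next
    case (Suc m)
    define E where "E a b \<delta> = {x \<in> ?S. a \<le> x m \<and> x m \<le> b \<and> (\<forall>i. m < i \<and> i \<le> p \<longrightarrow> \<bar>x i - y i\<bar> \<le> \<delta>)}"
      for a b \<delta>
    have closed: "closed (E a b \<delta>)" for a b \<delta>
    proof -
      have "E a b \<delta> = ?S \<inter> {x. a \<le> x m} \<inter> {x. x m \<le> b} \<inter> (\<Inter>i\<in>{m<..p}. {x. \<bar>x i - y i\<bar> \<le> \<delta>})"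
        by (auto simp: E_def)
      moreover have "closed {x. \<bar>x i - y i\<bar> \<le> \<delta>}" for i
        by (intro closed_Collect_le continuous_intros continuous_on_product_coordinates)
      moreover have "closed {x::nat \<Rightarrow> real. a \<le> x m}" "closed {x::nat \<Rightarrow> real. x m \<le> b}"
        by (intro closed_Collect_le continuous_intros continuous_on_product_coordinates)+
      ultimately show ?thesis by (auto intro!: closed_Int closed_INT closed_standard_simplex)
    qed
    have conn: "connected (E a b \<delta>)" for a b \<delta>
    proof (rule connected_if_segments)
      fix x z t assume x: "x \<in> E a b \<delta>" and z: "z \<in> E a b \<delta>" and t: "0 \<le> t" "t \<le> (1::real)"
      have abs: "\<bar>((1 - t) * x i + t * z i) - y i\<bar> \<le> \<delta>" if "\<bar>x i - y i\<bar> \<le> \<delta>" "\<bar>z i - y i\<bar> \<le> \<delta>" for i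
      proof -
        have "\<bar>((1 - t) * x i + t * z i) - y i\<bar> = \<bar>(1 - t) * (x i - y i) + t * (z i - y i)\<bar>"
          by (simp add: algebra_simps)
        also have "\<dots> \<le> (1 - t) * \<bar>x i - y i\<bar> + t * \<bar>z i - y i\<bar>"
          using t abs_triangle_ineq[of "(1 - t) * (x i - y i)" "t * (z i - y i)"] by (simp add: abs_mult)
        also have "\<dots> \<le> \<delta>" using that t by (intro convex_bound_le) auto
        finally show ?thesis .
      qed
      have "a \<le> (1 - t) * x m + t * z m"
        using x z t convex_bound_le[of "- x m" "- a" "- z m" "1 - t" t] by (auto simp: E_def)
      moreover have "(1 - t) * x m + t * z m \<le> b"
        using x z t by (intro convex_bound_le) (auto simp: E_def)
      ultimately show "(\<lambda>i. (1 - t) * x i + t * z i) \<in> E a b \<delta>"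
        using x z t abs convex_standard_simplex[of x p z t] by (auto simp: E_def)
    qed
    have "\<exists>\<delta>>0. config_liftable k X f (E 0 1 \<delta>)"
    \<comment> \<open>Short intervals around \<open>t\<close> are handled by the induction
      hypothesis with \<open>t\<close> as the centre in coordinate \<open>m\<close>. The tolerance
      \<open>\<delta>\<close> depends on \<open>t\<close>; joining two adjacent intervals replaces
      it by the minimum.\<close>
    proof (rule Bolzano[of 0 1 "\<lambda>a b. \<exists>\<delta>>0. config_liftable k X f (E a b \<delta>)"])
      fix a b c :: real assume abc: "a \<le> b" "b \<le> c"
      assume "\<exists>\<delta>>0. config_liftable k X f (E a b \<delta>)" "\<exists>\<delta>>0. config_liftable k X f (E b c \<delta>)"
      then obtain \<delta>1 \<delta>2 where \<delta>: "\<delta>1 > 0" "\<delta>2 > 0" "config_liftable k X f (E a b \<delta>1)"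
          "config_liftable k X f (E b c \<delta>2)" by blast
      define \<delta> where "\<delta> = min \<delta>1 \<delta>2"
      \<comment> \<open>The two slabs meet in the slice \<open>x m = b\<close>, which is again
        convex: this is the connected overlap that gluing needs.\<close>
      have "E a b \<delta> \<inter> E b c \<delta> = E b b \<delta>" "E a c \<delta> = E a b \<delta> \<union> E b c \<delta>"
        using abc by (auto simp: E_def)
      moreover have "config_liftable k X f (E a b \<delta>)" "config_liftable k X f (E b c \<delta>)"
        by (rule config_liftable_subset[OF \<delta>(3)], force simp: E_def \<delta>_def,
            rule config_liftable_subset[OF \<delta>(4)], force simp: E_def \<delta>_def)
      ultimately have "config_liftable k X f (E a c \<delta>)"
        using config_liftable_Un[OF X closed closed, of a b \<delta> b c \<delta>] conn by simp
      then show "\<exists>\<delta>>0. config_liftable k X f (E a c \<delta>)" using \<delta>(1,2) by (intro exI[of _ \<delta>]) (auto simp: \<delta>_def)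
    next
      fix t :: real
      obtain \<delta> where \<delta>: "\<delta> > 0" "config_liftable k X f (D m (y(m := t)) \<delta>)"
        using Suc.IH[of "y(m := t)"] Suc.prems by (metis Suc_leD)
      have "E a b \<delta> \<subseteq> D m (y(m := t)) \<delta>" if "a \<le> t" "t \<le> b" "b - a < \<delta>" for a b
        using that by (auto simp: E_def D_def)
      then show "\<exists>d>0. \<forall>a b. a \<le> t \<and> t \<le> b \<and> b - a < d \<longrightarrow> (\<exists>\<delta>>0. config_liftable k X f (E a b \<delta>))"
        using \<delta>(1) config_liftable_subset[OF \<delta>(2)] by (intro exI[of _ \<delta>] conjI allI impI) auto
    qed simp
    moreover have "E 0 1 \<delta> = D (Suc m) y \<delta>" for \<delta>
      by (auto simp: E_def D_def standard_simplex_def Suc_le_eq)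
    ultimately show ?case by simp
  qed
  from this[of "Suc p" undefined] show ?thesis
    by (auto simp: D_def intro: config_liftable_subset)
qed

lemma singular_simplex_config_lift:
  assumes X: "Hausdorff_space X" and f: "singular_simplex p (unordered_config_space k X) f"
  obtains g where "singular_simplex p (ordered_config_space k X) g" "f = simplex_map p (perm_orbit k) g"
proof -
  have "config_liftable k X f (standard_simplex p)"
    using f by (intro config_liftable_standard_simplex X) (simp add: singular_simplex_def euclidean_product_topology)
  then obtain g where g: "continuous_map (top_of_set (standard_simplex p)) (ordered_config_space k X) g"
      "\<And>x. x \<in> standard_simplex p \<Longrightarrow> perm_orbit k (g x) = f x"
    by (auto simp: config_liftable_def)
  show ?thesis
  proof
    show "singular_simplex p (ordered_config_space k X) (restrict g (standard_simplex p))"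
      using g(1) by (simp add: singular_simplex_def euclidean_product_topology)
    show "f = simplex_map p (perm_orbit k) (restrict g (standard_simplex p))"
      using f g(2) by (auto simp: singular_simplex_def simplex_map_def extensional_def fun_eq_iff)
  qed
qed

lemma singular_simplex_config_lift_unique:
  assumes X: "Hausdorff_space X"
    and g: "singular_simplex p (ordered_config_space k X) g" and h: "singular_simplex p (ordered_config_space k X) h"
    and eq: "simplex_map p (perm_orbit k) g = simplex_map p (perm_orbit k) h"
  obtains \<sigma> where "\<sigma> permutes {..<k}" "\<And>x. x \<in> standard_simplex p \<Longrightarrow> g x = h x \<circ> \<sigma>"
proof -
  let ?Z = "subtopology (powertop_real UNIV) (standard_simplex p)"
  have "connected_space ?Z" using connectedin_standard_simplex by (simp add: connectedin_def)
  moreover have "perm_orbit k (g x) = perm_orbit k (h x)" if "x \<in> standard_simplex p" for x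
    using fun_cong[OF eq, of x] that by (simp add: simplex_map_def)
  moreover have "continuous_map ?Z (ordered_config_space k X) g" "continuous_map ?Z (ordered_config_space k X) h"
    using g h by (simp_all add: singular_simplex_def)
  ultimately show ?thesis
    using that by (elim config_lift_unique[OF X, of ?Z k g h]) simp_all
qed

section \<open>Transfer\<close>

lemma chain_map_comp: "chain_map p h (chain_map p g c) = chain_map p (h \<circ> g) c"
  by (simp add: chain_map_compose)

text \<open>The map induced by \<open>G\<close> on orbits, evaluated on a chosen representative. The
  choice does not matter once the set of points of \<open>G x\<close> depends only on the set of
  points of \<open>x\<close>; unlike equivariance, this condition makes sense unchanged when the
  number of points changes.\<close>

definition orbit_map :: "nat \<Rightarrow> ((nat \<Rightarrow> 'a) \<Rightarrow> nat \<Rightarrow> 'b) \<Rightarrow> (nat \<Rightarrow> 'a) set \<Rightarrow> (nat \<Rightarrow> 'b) set" where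
  "orbit_map m G c = perm_orbit m (G (SOME x. x \<in> c))"

lemma orbit_map_perm_orbit:
  assumes G: "\<And>x. x \<in> topspace (ordered_config_space k X) \<Longrightarrow> G x \<in> topspace (ordered_config_space m Y)"
    and im: "\<And>x y. x \<in> topspace (ordered_config_space k X) \<Longrightarrow> y \<in> topspace (ordered_config_space k X) \<Longrightarrow>
               x ` {..<k} = y ` {..<k} \<Longrightarrow> G x ` {..<m} = G y ` {..<m}"
    and x: "x \<in> topspace (ordered_config_space k X)"
  shows "orbit_map m G (perm_orbit k x) = perm_orbit m (G x)"
proof -
  define y where "y = (SOME y. y \<in> perm_orbit k x)"
  have "y \<in> perm_orbit k x" unfolding y_def by (rule someI[of "\<lambda>y. y \<in> perm_orbit k x" x, OF perm_orbit_self])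
  then obtain \<sigma> where \<sigma>: "\<sigma> permutes {..<k}" "y = x \<circ> \<sigma>" by (auto simp: perm_orbit_def)
  have y: "y \<in> topspace (ordered_config_space k X)" using permutes_compose_config[OF x \<sigma>(1)] \<sigma>(2) by simp
  have "y ` {..<k} = x ` {..<k}" using \<sigma> by (simp only: image_comp[symmetric] permutes_image)
  then have "perm_orbit m (G y) = perm_orbit m (G x)"
    using perm_orbit_eq_iff_image[OF G[OF y] G[OF x]] im[OF y x] by simp
  then show ?thesis by (simp add: orbit_map_def y_def)
qed

lemma continuous_map_orbit_map:
  assumes G: "continuous_map (ordered_config_space k X) (ordered_config_space m Y) G"
    and im: "\<And>x y. x \<in> topspace (ordered_config_space k X) \<Longrightarrow> y \<in> topspace (ordered_config_space k X) \<Longrightarrow>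
               x ` {..<k} = y ` {..<k} \<Longrightarrow> G x ` {..<m} = G y ` {..<m}"
  shows "continuous_map (unordered_config_space k X) (unordered_config_space m Y) (orbit_map m G)"
proof (rule continuous_compose_quotient_map[OF quotient_map_perm_orbit])
  have "continuous_map (ordered_config_space k X) (unordered_config_space m Y) (perm_orbit m \<circ> G)"
    using G continuous_map_perm_orbit by (rule continuous_map_compose)
  then show "continuous_map (ordered_config_space k X) (unordered_config_space m Y) (orbit_map m G \<circ> perm_orbit k)"
  proof (rule continuous_map_eq)
    fix x assume x: "x \<in> topspace (ordered_config_space k X)"
    show "(perm_orbit m \<circ> G) x = (orbit_map m G \<circ> perm_orbit k) x"
      unfolding o_apply
      by (rule orbit_map_perm_orbit[OF _ im x, symmetric]) (use G in \<open>auto simp: continuous_map_def\<close>)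
  qed
qed

section \<open>Moving, adding and dropping points of ordered configurations\<close>

definition config_map :: "nat \<Rightarrow> ('a \<Rightarrow> 'b) \<Rightarrow> (nat \<Rightarrow> 'a) \<Rightarrow> nat \<Rightarrow> 'b" where
  "config_map k e x = restrict (e \<circ> x) {..<k}"

definition config_add :: "nat \<Rightarrow> ('a \<Rightarrow> 'b) \<Rightarrow> 'b \<Rightarrow> (nat \<Rightarrow> 'a) \<Rightarrow> nat \<Rightarrow> 'b" where
  "config_add k e p x = restrict ((e \<circ> x)(k := p)) {..<Suc k}"

text \<open>The gap at \<open>j\<close> is filled with the last point instead of shifting the later
  ones, since only the set of remaining points counts after passing to orbits. For
  \<open>j = k - 1\<close> this merely truncates.\<close>

definition config_remove :: "nat \<Rightarrow> nat \<Rightarrow> (nat \<Rightarrow> 'a) \<Rightarrow> nat \<Rightarrow> 'a" where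
  "config_remove k j x = restrict (x(j := x (k - 1))) {..<k - 1}"

lemma config_map_image: "config_map k e x ` {..<k} = e ` x ` {..<k}"
  by (auto simp: config_map_def)

lemma config_add_image: "config_add k e p x ` {..<Suc k} = insert p (e ` x ` {..<k})"
  by (force simp: config_add_def)

lemma config_remove_image:
  assumes "inj_on x {..<k}" "j < k"
  shows "config_remove k j x ` {..<k - 1} = x ` {..<k} - {x j}"
proof -
  have "config_remove k j x ` {..<k - 1} = x ` ({..<k} - {j})"
  proof
    show "config_remove k j x ` {..<k - 1} \<subseteq> x ` ({..<k} - {j})"
      using assms(2) by (auto simp: config_remove_def)
    show "x ` ({..<k} - {j}) \<subseteq> config_remove k j x ` {..<k - 1}"
    proof
      fix b assume "b \<in> x ` ({..<k} - {j})"
      then obtain i where i: "i < k" "i \<noteq> j" "b = x i" by blast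
      let ?i = "if i = k - 1 then j else i"
      have "?i \<in> {..<k - 1}" "config_remove k j x ?i = x i"
        using i assms(2) by (auto simp: config_remove_def)
      then show "b \<in> config_remove k j x ` {..<k - 1}" using i(3) by (metis image_eqI)
    qed
  qed
  then show ?thesis using assms by (simp add: inj_on_image_set_diff[where C = "{..<k}"])
qed

lemma continuous_map_config_map:
  assumes "continuous_map X Y e" "inj_on e (topspace X)"
  shows "continuous_map (ordered_config_space k X) (ordered_config_space k Y) (config_map k e)"
  unfolding continuous_map_into_ordered_config_space
proof (intro conjI allI impI ballI)
  fix i assume i: "i < k"
  then show "continuous_map (ordered_config_space k X) Y (\<lambda>x. config_map k e x i)"
    using continuous_map_compose[OF continuous_map_config_coordinate[OF i] assms(1)]
    by (simp add: config_map_def o_def)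
next
  fix x assume "x \<in> topspace (ordered_config_space k X)"
  then show "inj_on (config_map k e x) {..<k}"
    using assms(2) by (auto simp: config_map_def topspace_ordered_config_space inj_on_def PiE_iff)
qed (auto simp: config_map_def)

lemma continuous_map_config_add:
  assumes "continuous_map X Y e" "inj_on e (topspace X)" "p \<in> topspace Y" "p \<notin> e ` topspace X"
  shows "continuous_map (ordered_config_space k X) (ordered_config_space (Suc k) Y) (config_add k e p)"
  unfolding continuous_map_into_ordered_config_space
proof (intro conjI allI impI ballI)
  fix i assume i: "i < Suc k"
  show "continuous_map (ordered_config_space k X) Y (\<lambda>x. config_add k e p x i)"
  proof (cases "i = k")
    case False
    then have "i < k" using i by simp
    then show ?thesis
      using continuous_map_compose[OF continuous_map_config_coordinate[OF \<open>i < k\<close>] assms(1)]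
      by (simp add: config_add_def o_def)
  qed (use assms(3) in \<open>simp add: config_add_def\<close>)
next
  fix x assume "x \<in> topspace (ordered_config_space k X)"
  then have "inj_on x {..<k}" and x: "x i \<in> topspace X" if "i < k" for i
    using that by (auto simp: topspace_ordered_config_space)
  then show "inj_on (config_add k e p x) {..<Suc k}"
    using assms(2,4) by (force simp: config_add_def inj_on_def less_Suc_eq)
qed (auto simp: config_add_def)

lemma continuous_map_config_remove:
  assumes j: "j < k"
  shows "continuous_map (ordered_config_space k X) (ordered_config_space (k - 1) X) (config_remove k j)"
  unfolding continuous_map_into_ordered_config_space
proof (intro conjI allI impI ballI)
  fix i assume i: "i < k - 1"
  show "continuous_map (ordered_config_space k X) X (\<lambda>x. config_remove k j x i)"
    using i j continuous_map_config_coordinate[of "k - 1" k X] continuous_map_config_coordinate[of i k X]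
    by (cases "i = j") (simp_all add: config_remove_def)
next
  fix x assume "x \<in> topspace (ordered_config_space k X)"
  then have "inj_on x {..<k}" by (auto simp: topspace_ordered_config_space)
  show "inj_on (config_remove k j x) {..<k - 1}"
  proof (rule inj_onI)
    fix a b assume ab: "a \<in> {..<k - 1}" "b \<in> {..<k - 1}" "config_remove k j x a = config_remove k j x b"
    let ?f = "\<lambda>a. if a = j then k - 1 else a"
    have "x (?f a) = x (?f b)" using ab by (auto simp: config_remove_def split: if_splits)
    moreover have "?f a < k" "?f b < k" using ab j by auto
    ultimately have "?f a = ?f b" using \<open>inj_on x {..<k}\<close> by (auto dest: inj_onD simp del: if_split)
    then show "a = b" using ab by (auto split: if_splits)
  qed
qed (auto simp: config_remove_def)

text \<open>The transfer of the \<open>k\<close>-sheeted covering by configurations with one marked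
  point, followed by forgetting that point. A lift labels the points consistently along the simplex,
  so the index \<open>j\<close> runs over the sheets.\<close>

definition transfer_simplex ::
  "nat \<Rightarrow> 'a topology \<Rightarrow> nat \<Rightarrow> ((nat \<Rightarrow> real) \<Rightarrow> (nat \<Rightarrow> 'a) set) \<Rightarrow> (nat \<Rightarrow> 'a) set chain" where
  "transfer_simplex k X p f =
     (let g = SOME g. singular_simplex p (ordered_config_space k X) g \<and> f = simplex_map p (perm_orbit k) g
      in \<Sum>j<k. frag_of (simplex_map p (perm_orbit (k - 1) \<circ> config_remove k j) g))"

definition transfer :: "nat \<Rightarrow> 'a topology \<Rightarrow> nat \<Rightarrow> (nat \<Rightarrow> 'a) set chain \<Rightarrow> (nat \<Rightarrow> 'a) set chain" where
  "transfer k X p = frag_extend (transfer_simplex k X p)"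

text \<open>Any other lift is \<open>g x \<circ> \<sigma>\<close> with one \<open>\<sigma>\<close>
  for the whole simplex. Dropping its entry \<open>j\<close> drops entry \<open>\<sigma> j\<close>
  of \<open>g x\<close>, so the two sums differ by reindexing.\<close>

lemma transfer_simplex_lift:
  assumes X: "Hausdorff_space X" and g: "singular_simplex p (ordered_config_space k X) g"
  shows "transfer_simplex k X p (simplex_map p (perm_orbit k) g) =
     (\<Sum>j<k. frag_of (simplex_map p (perm_orbit (k - 1) \<circ> config_remove k j) g))"
proof -
  define h where "h = (SOME h. singular_simplex p (ordered_config_space k X) h \<and>
      simplex_map p (perm_orbit k) g = simplex_map p (perm_orbit k) h)"
  have h: "singular_simplex p (ordered_config_space k X) h"
      "simplex_map p (perm_orbit k) g = simplex_map p (perm_orbit k) h"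
    using someI[of "\<lambda>h. singular_simplex p (ordered_config_space k X) h \<and>
      simplex_map p (perm_orbit k) g = simplex_map p (perm_orbit k) h" g] g by (simp_all add: h_def)
  obtain \<sigma> where \<sigma>: "\<sigma> permutes {..<k}" "\<And>x. x \<in> standard_simplex p \<Longrightarrow> h x = g x \<circ> \<sigma>"
    by (rule singular_simplex_config_lift_unique[OF X h(1) g h(2)[symmetric]]) (use that in blast)
  have eq: "simplex_map p (perm_orbit (k - 1) \<circ> config_remove k j) h =
        simplex_map p (perm_orbit (k - 1) \<circ> config_remove k (\<sigma> j)) g" if j: "j < k" for j
  proof -
    have \<sigma>j: "\<sigma> j < k" using permutes_in_image[OF \<sigma>(1), of j] j by simp
    have "perm_orbit (k - 1) (config_remove k j (h x)) = perm_orbit (k - 1) (config_remove k (\<sigma> j) (g x))"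
      if x: "x \<in> standard_simplex p" for x
    proof -
      have gx: "g x \<in> topspace (ordered_config_space k X)" and hx: "h x \<in> topspace (ordered_config_space k X)"
        using g h(1) x by (auto simp: singular_simplex_def continuous_map_def)
      have "config_remove k j (h x) ` {..<k - 1} = h x ` {..<k} - {h x j}"
        using hx j by (intro config_remove_image) (auto simp: topspace_ordered_config_space)
      also have "\<dots> = g x ` {..<k} - {g x (\<sigma> j)}"
        unfolding \<sigma>(2)[OF x] by (simp only: image_comp[symmetric] permutes_image[OF \<sigma>(1)] o_apply)
      also have "\<dots> = config_remove k (\<sigma> j) (g x) ` {..<k - 1}"
        using gx \<sigma>j by (intro config_remove_image[symmetric]) (auto simp: topspace_ordered_config_space)
      finally show ?thesis
        using continuous_map_config_remove[OF j, of X] continuous_map_config_remove[OF \<sigma>j, of X] gx hx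
        by (subst perm_orbit_eq_iff_image[of _ _ X _ X]) (auto simp: continuous_map_def Pi_iff)
    qed
    then show ?thesis by (auto simp: simplex_map_def fun_eq_iff restrict_def)
  qed
  have "transfer_simplex k X p (simplex_map p (perm_orbit k) g) =
      (\<Sum>j<k. frag_of (simplex_map p (perm_orbit (k - 1) \<circ> config_remove k j) h))"
    by (simp add: transfer_simplex_def h_def)
  also have "\<dots> = (\<Sum>j<k. frag_of (simplex_map p (perm_orbit (k - 1) \<circ> config_remove k (\<sigma> j)) g))"
    by (intro sum.cong refl) (simp only: eq lessThan_iff)
  also have "\<dots> = (\<Sum>j<k. frag_of (simplex_map p (perm_orbit (k - 1) \<circ> config_remove k j) g))"
    using sum.permute[OF \<sigma>(1), of "\<lambda>j. frag_of (simplex_map p (perm_orbit (k - 1) \<circ> config_remove k j) g)"]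
    by (simp add: o_def)
  finally show ?thesis .
qed

lemma transfer_diff: "transfer k X p (a - b) = transfer k X p a - transfer k X p b"
  by (simp add: transfer_def frag_extend_diff)

lemma transfer_add: "transfer k X p (a + b) = transfer k X p a + transfer k X p b"
  by (simp add: transfer_def frag_extend_add)

lemma transfer_cmul: "transfer k X p (frag_cmul a c) = frag_cmul a (transfer k X p c)"
  by (simp add: transfer_def frag_extend_cmul)

lemma transfer_0 [simp]: "transfer k X p 0 = 0"
  by (simp add: transfer_def)

text \<open>This makes the transfer computable: once a chain is written as the image of a chain of
  ordered configurations, its transfer is a sum of ordinary chain maps.\<close>

lemma transfer_chain_map:
  assumes X: "Hausdorff_space X" and c: "singular_chain p (ordered_config_space k X) c"
  shows "transfer k X p (chain_map p (perm_orbit k) c) =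
     (\<Sum>j<k. chain_map p (perm_orbit (k - 1) \<circ> config_remove k j) c)"
  using c unfolding singular_chain_def
proof (induction c rule: frag_induction)
  case (one g)
  then show ?case using transfer_simplex_lift[OF X, of p k g] by (simp add: transfer_def o_def)
qed (simp_all add: chain_map_diff transfer_diff sum_subtractf)

text \<open>Simplices are lifted one by one with unrelated labellings, so the lift of a cycle need
  not be a cycle.\<close>

lemma singular_chain_config_lift:
  assumes X: "Hausdorff_space X" and z: "singular_chain p (unordered_config_space k X) z"
  obtains c where "singular_chain p (ordered_config_space k X) c" "z = chain_map p (perm_orbit k) c"
proof -
  have "\<exists>c. singular_chain p (ordered_config_space k X) c \<and> z = chain_map p (perm_orbit k) c"
    using z unfolding singular_chain_def[of _ "unordered_config_space k X"]
  proof (induction z rule: frag_induction)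
    case zero
    show ?case by (intro exI[of _ 0]) simp
  next
    case (one f)
    then obtain g where "singular_simplex p (ordered_config_space k X) g" "f = simplex_map p (perm_orbit k) g"
      using singular_simplex_config_lift[OF X] by blast
    then show ?case by (intro exI[of _ "frag_of g"]) (simp add: singular_chain_of)
  next
    case (diff a b)
    then obtain c d where "singular_chain p (ordered_config_space k X) c" "a = chain_map p (perm_orbit k) c"
      "singular_chain p (ordered_config_space k X) d" "b = chain_map p (perm_orbit k) d" by blast
    then show ?case by (intro exI[of _ "c - d"]) (simp add: singular_chain_diff chain_map_diff)
  qed
  then show ?thesis using that by blast
qed

lemma continuous_map_orbit_remove:
  "j < k \<Longrightarrow> continuous_map (ordered_config_space k X) (unordered_config_space (k - 1) X)
     (perm_orbit (k - 1) \<circ> config_remove k j)"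
  by (rule continuous_map_compose[OF continuous_map_config_remove continuous_map_perm_orbit])

lemma singular_chain_transfer:
  assumes X: "Hausdorff_space X" and z: "singular_chain p (unordered_config_space k X) z"
  shows "singular_chain p (unordered_config_space (k - 1) X) (transfer k X p z)"
proof -
  obtain c where c: "singular_chain p (ordered_config_space k X) c" "z = chain_map p (perm_orbit k) c"
    using singular_chain_config_lift[OF X z] .
  show ?thesis
    unfolding c(2) transfer_chain_map[OF X c(1)]
    by (intro singular_chain_sum singular_chain_chain_map[OF c(1)] continuous_map_orbit_remove) auto
qed

text \<open>If \<open>c\<close> lifts \<open>z\<close>, then the boundary of \<open>c\<close> lifts
  the boundary of \<open>z\<close>, so both sides are given by
  \<open>transfer_chain_map\<close>.\<close>

lemma chain_boundary_transfer:
  assumes X: "Hausdorff_space X" and z: "singular_chain p (unordered_config_space k X) z"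
  shows "chain_boundary p (transfer k X p z) = transfer k X (p - 1) (chain_boundary p z)"
proof -
  obtain c where c: "singular_chain p (ordered_config_space k X) c" "z = chain_map p (perm_orbit k) c"
    using singular_chain_config_lift[OF X z] .
  have "chain_boundary p (transfer k X p z) =
      (\<Sum>j<k. chain_map (p - 1) (perm_orbit (k - 1) \<circ> config_remove k j) (chain_boundary p c))"
    unfolding c(2) transfer_chain_map[OF X c(1)] chain_boundary_sum
    by (simp only: o_def chain_boundary_chain_map[OF c(1)] One_nat_def)
  also have "\<dots> = transfer k X (p - 1) (chain_map (p - 1) (perm_orbit k) (chain_boundary p c))"
    using transfer_chain_map[OF X singular_chain_boundary[OF c(1)]] by simp
  finally show ?thesis
    unfolding c(2) by (simp add: chain_boundary_chain_map[OF c(1)])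
qed

lemma singular_relcycle_transfer:
  assumes X: "Hausdorff_space X" and z: "singular_relcycle p (unordered_config_space k X) {} z"
  shows "singular_relcycle p (unordered_config_space (k - 1) X) {} (transfer k X p z)"
  using z singular_chain_transfer[OF X, of p k z] chain_boundary_transfer[OF X, of p k z]
  by (simp add: singular_cycle)

lemma singular_relboundary_transfer:
  assumes X: "Hausdorff_space X" and z: "singular_relboundary p (unordered_config_space k X) {} z"
  shows "singular_relboundary p (unordered_config_space (k - 1) X) {} (transfer k X p z)"
proof -
  obtain d where d: "singular_chain (Suc p) (unordered_config_space k X) d" "chain_boundary (Suc p) d = z"
    using z by (auto simp: singular_boundary)
  show ?thesis
    unfolding singular_boundary
    using singular_chain_transfer[OF X d(1)] chain_boundary_transfer[OF X d(1)] d(2)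
    by (intro exI[of _ "transfer k X (Suc p) d"]) simp
qed

section \<open>Stabilisation\<close>

locale config_stabilization =
  fixes X :: "'a topology" and e :: "'a \<Rightarrow> 'a" and p :: 'a
  assumes Hausdorff: "Hausdorff_space X"
    and homotopic: "homotopic_with (\<lambda>f. inj_on f (topspace X)) X X id e"
    and p: "p \<in> topspace X" "p \<notin> e ` topspace X"
begin

lemma e: "continuous_map X X e" "inj_on e (topspace X)"
  using homotopic_with_imp_continuous_maps[OF homotopic] homotopic_with_imp_property[OF homotopic] by auto

abbreviation "F k \<equiv> ordered_config_space k X"
abbreviation "C k \<equiv> unordered_config_space k X"

definition "stab k = orbit_map (Suc k) (config_add k e p)"
definition "emap k = orbit_map k (config_map k e)"

section \<open>Stabilisation and the isotopy on unordered configurations\<close>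

lemma config_add_closed: "x \<in> topspace (F k) \<Longrightarrow> config_add k e p x \<in> topspace (F (Suc k))"
  using continuous_map_config_add[OF e p, of k] by (auto simp: continuous_map_def)

lemma config_map_closed: "x \<in> topspace (F k) \<Longrightarrow> config_map k e x \<in> topspace (F k)"
  using continuous_map_config_map[OF e, of k] by (auto simp: continuous_map_def)

lemma config_remove_closed: "x \<in> topspace (F k) \<Longrightarrow> j < k \<Longrightarrow> config_remove k j x \<in> topspace (F (k - 1))"
  using continuous_map_config_remove[of j k X] by (auto simp: continuous_map_def)

lemma stab_perm_orbit:
  "x \<in> topspace (F k) \<Longrightarrow> stab k (perm_orbit k x) = perm_orbit (Suc k) (config_add k e p x)"
  unfolding stab_def by (rule orbit_map_perm_orbit[OF config_add_closed]) (simp_all only: config_add_image)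

lemma emap_perm_orbit:
  "x \<in> topspace (F k) \<Longrightarrow> emap k (perm_orbit k x) = perm_orbit k (config_map k e x)"
  unfolding emap_def by (rule orbit_map_perm_orbit[OF config_map_closed]) (simp_all only: config_map_image)

lemma continuous_map_stab: "continuous_map (C k) (C (Suc k)) (stab k)"
  unfolding stab_def
  by (rule continuous_map_orbit_map[OF continuous_map_config_add[OF e p]]) (simp only: config_add_image)

text \<open>The homotopy moves all points of a configuration simultaneously; they stay distinct
  because every stage is injective. It descends to orbits because the orbit map times the identity
  of the interval is still a quotient map, the interval being locally compact and Hausdorff.\<close>

lemma homotopic_emap: "homotopic_with (\<lambda>_. True) (C k) (C k) id (emap k)"
proof -
  obtain h where h: "continuous_map (prod_topology (top_of_set {0..1::real}) X) X h"
      "\<And>x. h (0, x) = x" "\<And>x. h (1, x) = e x" "\<And>t. t \<in> {0..1} \<Longrightarrow> inj_on (\<lambda>x. h (t, x)) (topspace X)"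
    using homotopic unfolding homotopic_with_def id_def by blast
  define H where "H = (\<lambda>(t, c). orbit_map k (config_map k (\<lambda>x. h (t, x))) c)"
  have ht: "continuous_map X X (\<lambda>x. h (t, x))" if "t \<in> {0..1}" for t
    using continuous_map_compose[OF _ h(1), of X "\<lambda>x. (t, x)"] that
    by (simp add: o_def continuous_map_pairwise)
  have Hq: "H (t, perm_orbit k x) = perm_orbit k (config_map k (\<lambda>x. h (t, x)) x)"
    if "t \<in> {0..1}" "x \<in> topspace (F k)" for t x
    unfolding H_def prod.case
    by (rule orbit_map_perm_orbit[of k X])
       (use continuous_map_config_map[OF ht[OF that(1)] h(4)[OF that(1)], of k] that(2) in
         \<open>auto simp: continuous_map_def config_map_image\<close>)
  let ?I = "top_of_set {0..1::real}"
  have quot: "quotient_map (prod_topology ?I (F k)) (prod_topology ?I (C k)) (\<lambda>(t, x). (t, perm_orbit k x))"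
    by (intro quotient_map_prod_right quotient_map_perm_orbit disjI1)
       (auto simp: Hausdorff_space_subtopology locally_compact_space_closed_subset
         intro!: compact_imp_locally_compact_space compact_space_subtopology)
  have "continuous_map (prod_topology ?I (F k)) (C k)
      (perm_orbit k \<circ> (\<lambda>(t, x). config_map k (\<lambda>x. h (t, x)) x))"
  proof (rule continuous_map_compose[OF _ continuous_map_perm_orbit])
    show "continuous_map (prod_topology ?I (F k)) (F k) (\<lambda>(t, x). config_map k (\<lambda>x. h (t, x)) x)"
      unfolding continuous_map_into_ordered_config_space
    proof (intro conjI allI impI ballI)
      fix i assume i: "i < k"
      have "continuous_map (prod_topology ?I (F k)) (prod_topology ?I X) (\<lambda>y. (fst y, snd y i))"
        using continuous_map_compose[OF continuous_map_snd continuous_map_config_coordinate[OF i]]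
        by (simp add: continuous_map_pairwise o_def continuous_map_fst)
      from continuous_map_compose[OF this h(1)]
      show "continuous_map (prod_topology ?I (F k)) X (\<lambda>z. (case z of (t, x) \<Rightarrow> config_map k (\<lambda>x. h (t, x)) x) i)"
        using i by (simp add: o_def config_map_def case_prod_unfold)
    next
      fix z assume "z \<in> topspace (prod_topology ?I (F k))"
      then obtain t x where z: "z = (t, x)" "t \<in> {0..1}" "x \<in> topspace (F k)" by auto
      then have "config_map k (\<lambda>x. h (t, x)) x \<in> topspace (F k)"
        using continuous_map_config_map[OF ht[OF z(2)] h(4)[OF z(2)], of k] by (auto simp: continuous_map_def)
      then show "inj_on (case z of (t, x) \<Rightarrow> config_map k (\<lambda>x. h (t, x)) x) {..<k}"
        by (simp add: z topspace_ordered_config_space)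
    qed (auto simp: config_map_def)
  qed
  then have "continuous_map (prod_topology ?I (F k)) (C k) (H \<circ> (\<lambda>(t, x). (t, perm_orbit k x)))"
    by (rule continuous_map_eq) (use Hq in auto)
  then have "continuous_map (prod_topology ?I (C k)) (C k) H"
    by (rule continuous_compose_quotient_map[OF quot])
  moreover have "H (0, c) = id c" "H (1, c) = emap k c" if "c \<in> topspace (C k)" for c
  proof -
    obtain x where x: "x \<in> topspace (F k)" "c = perm_orbit k x"
      using \<open>c \<in> topspace (C k)\<close> by (auto simp: topspace_unordered_config_space)
    have "config_map k (\<lambda>x. x) x = x"
      using x(1) by (auto simp: config_map_def topspace_ordered_config_space PiE_iff extensional_def fun_eq_iff)
    then show "H (0, c) = id c" using Hq[of 0 x] x by (simp add: h(2))
    show "H (1, c) = emap k c" by (simp add: H_def emap_def h(3))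
  qed
  ultimately show ?thesis
    by (subst homotopic_with) auto
qed

text \<open>Dropping the new point \<open>p\<close> undoes the stabilisation up to \<open>e\<close>.
  This is the source of the identity term in the relation between transfer and
  stabilisation.\<close>

lemma remove_last_config_add:
  assumes x: "x \<in> topspace (F k)"
  shows "perm_orbit k (config_remove (Suc k) k (config_add k e p x)) = emap k (perm_orbit k x)"
proof -
  have "inj_on (config_add k e p x) {..<Suc k}"
    using config_add_closed[OF x] by (simp add: topspace_ordered_config_space)
  moreover have "config_add k e p x k = p" by (simp add: config_add_def)
  ultimately have "config_remove (Suc k) k (config_add k e p x) ` {..<k} = insert p (e ` x ` {..<k}) - {p}"
    using config_remove_image[of "config_add k e p x" "Suc k" k] config_add_image[of k e p x] by simp
  also have "\<dots> = e ` x ` {..<k}" using x p by (auto simp: topspace_ordered_config_space)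
  also have "\<dots> = config_map k e x ` {..<k}" by (simp add: config_map_image)
  finally show ?thesis
    using config_remove_closed[OF config_add_closed[OF x], of k] config_map_closed[OF x]
    by (simp add: emap_perm_orbit[OF x] perm_orbit_eq_iff_image[of _ k X _ X])
qed

text \<open>Dropping an old point commutes with adding \<open>p\<close>: injectivity of
  \<open>e\<close> lets the image pass through the set difference, and \<open>p\<close> survives
  because it is not in the image of \<open>e\<close>.\<close>

lemma remove_config_add:
  assumes x: "x \<in> topspace (F k)" and j: "j < k"
  shows "perm_orbit k (config_remove (Suc k) j (config_add k e p x)) =
    stab (k - 1) (perm_orbit (k - 1) (config_remove k j x))"
proof -
  have inj: "inj_on (config_add k e p x) {..<Suc k}" "inj_on x {..<k}"
    using config_add_closed[OF x] x by (simp_all add: topspace_ordered_config_space)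
  have xX: "x ` {..<k} \<subseteq> topspace X" using x by (auto simp: topspace_ordered_config_space)
  have k: "Suc (k - 1) = k" using j by simp
  have "config_remove (Suc k) j (config_add k e p x) ` {..<k} = insert p (e ` x ` {..<k}) - {e (x j)}"
    using config_remove_image[OF inj(1), of j] config_add_image[of k e p x] j
    by (simp add: config_add_def)
  also have "\<dots> = insert p (e ` (x ` {..<k} - {x j}))"
  proof -
    have "p \<noteq> e (x j)" using p xX j by auto
    moreover have "e ` (x ` {..<k} - {x j}) = e ` x ` {..<k} - {e (x j)}"
      using inj_on_image_set_diff[OF e(2), of "x ` {..<k}" "{x j}"] xX j by auto
    ultimately show ?thesis by auto
  qed
  also have "\<dots> = config_add (k - 1) e p (config_remove k j x) ` {..<k}"
    using config_add_image[of "k - 1" e p "config_remove k j x"] config_remove_image[OF inj(2) j]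
    unfolding k by simp
  finally show ?thesis
    using config_remove_closed[OF config_add_closed[OF x], of j] j
      config_add_closed[OF config_remove_closed[OF x j]] k
    by (simp add: stab_perm_orbit[OF config_remove_closed[OF x j], simplified] perm_orbit_eq_iff_image[of _ k X _ X])
qed

text \<open>With \<open>emap\<close> in place of the identity the relation holds exactly on chains;
  the homotopy enters only later. The index \<open>j = k\<close> contributes the \<open>emap\<close>
  term. For \<open>k = 0\<close> the sum over \<open>j < k\<close> is empty, so the truncated
  \<open>k - 1\<close> does no harm.\<close>

lemma transfer_stab:
  assumes z: "singular_chain i (C k) z"
  shows "transfer (Suc k) X i (chain_map i (stab k) z) =
     chain_map i (stab (k - 1)) (transfer k X i z) + chain_map i (emap k) z"
proof -
  obtain c where c: "singular_chain i (F k) c" "z = chain_map i (perm_orbit k) c"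
    using singular_chain_config_lift[OF Hausdorff z] .
  have add: "singular_chain i (F (Suc k)) (chain_map i (config_add k e p) c)"
    by (rule singular_chain_chain_map[OF c(1) continuous_map_config_add[OF e p]])
  have "chain_map i (stab k) z = chain_map i (perm_orbit (Suc k)) (chain_map i (config_add k e p) c)"
    unfolding c(2) chain_map_comp by (rule chain_map_eq[OF c(1)]) (simp add: stab_perm_orbit)
  then have "transfer (Suc k) X i (chain_map i (stab k) z) =
      (\<Sum>j<Suc k. chain_map i (perm_orbit k \<circ> config_remove (Suc k) j \<circ> config_add k e p) c)"
    using transfer_chain_map[OF Hausdorff add] by (simp add: chain_map_comp)
  also have "\<dots> = (\<Sum>j<k. chain_map i (stab (k - 1) \<circ> (perm_orbit (k - 1) \<circ> config_remove k j)) c) +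
      chain_map i (emap k \<circ> perm_orbit k) c"
    unfolding sum.lessThan_Suc
  proof (intro arg_cong2[of _ _ _ _ "(+)"] sum.cong refl chain_map_eq[OF c(1)])
    show "(perm_orbit k \<circ> config_remove (Suc k) k \<circ> config_add k e p) x = (emap k \<circ> perm_orbit k) x"
      if "x \<in> topspace (F k)" for x using remove_last_config_add[OF that] by simp
    show "(perm_orbit k \<circ> config_remove (Suc k) j \<circ> config_add k e p) x =
        (stab (k - 1) \<circ> (perm_orbit (k - 1) \<circ> config_remove k j)) x"
      if "j \<in> {..<k}" "x \<in> topspace (F k)" for j x using remove_config_add[OF that(2), of j] that(1) by simp
  qed
  also have "\<dots> = chain_map i (stab (k - 1)) (transfer k X i z) + chain_map i (emap k) z"
    unfolding c(2) transfer_chain_map[OF Hausdorff c(1)]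
    by (simp only: chain_map_sum finite_lessThan o_def chain_map_comp[unfolded o_def])
  finally show ?thesis .
qed

section \<open>Injectivity of stabilisation modulo torsion\<close>

abbreviation "cyc i k z \<equiv> singular_relcycle i (C k) {} z"
abbreviation "bd i k z \<equiv> singular_relboundary i (C k) {} z"

lemma emap_homologous:
  assumes "cyc i k z"
  shows "bd i k (chain_map i (emap k) z - z)"
proof -
  have "homotopic_with (\<lambda>h. h \<in> {} \<rightarrow> {}) (C k) (C k) id (emap k)"
    using homotopic_emap by simp
  from homotopic_imp_homologous_rel_chain_maps[OF this assms]
  have "homologous_rel i (C k) {} (chain_map i (emap k) z) (chain_map i id z)"
    by (subst homologous_rel_sym)
  moreover have "chain_map i id z = z"
    by (rule chain_map_id_gen[of i "C k"]) (use assms in \<open>simp_all add: singular_cycle\<close>)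
  ultimately show ?thesis by (simp only: homologous_rel_def)
qed

lemma bd_stab: "bd i k z \<Longrightarrow> bd i (Suc k) (chain_map i (stab k) z)"
  by (rule singular_relboundary_chain_map[OF _ continuous_map_stab]) auto

lemma bd_combination_torsion:
  assumes "a > 0" "cyc i k z" "bd i k (frag_cmul a z + chain_map i (stab (k - 1)) (transfer k X i z))"
  shows "\<exists>N>0. bd i k (frag_cmul N z)"
  using assms
proof (induction k arbitrary: a z)
  case 0
  have "singular_chain i (C 0) z" using 0 by (simp add: singular_cycle)
  then obtain c where c: "singular_chain i (F 0) c" "z = chain_map i (perm_orbit 0) c"
    using singular_chain_config_lift[OF Hausdorff] by metis
  \<comment> \<open>With no points there is nothing to drop, so the sum is empty and
    \<open>a\<close> itself is the required multiple.\<close>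
  have "transfer 0 X i z = 0" unfolding c(2) transfer_chain_map[OF Hausdorff c(1)] by simp
  then show ?case using 0 by auto
next
  case (Suc k)
  let ?w = "transfer (Suc k) X i z"
  let ?S = "\<lambda>k. chain_map i (stab k)"
  have w: "cyc i k ?w" using singular_relcycle_transfer[OF Hausdorff Suc.prems(2)] by simp
  have "bd i k (transfer (Suc k) X i (frag_cmul a z + ?S k ?w))"
    using singular_relboundary_transfer[OF Hausdorff Suc.prems(3)] by simp
  moreover have "transfer (Suc k) X i (frag_cmul a z + ?S k ?w) =
      frag_cmul a ?w + (?S (k - 1) (transfer k X i ?w) + chain_map i (emap k) ?w)"
    using transfer_stab[of i k ?w] w by (simp add: transfer_add transfer_cmul singular_cycle)
  \<comment> \<open>Subtracting the boundary \<open>emap ?w - ?w\<close> trades the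
    \<open>emap\<close> term for one more copy of \<open>?w\<close>, so \<open>a\<close> becomes
    \<open>a + 1\<close>.\<close>
  ultimately have "bd i k (frag_cmul a ?w + (?S (k - 1) (transfer k X i ?w) + chain_map i (emap k) ?w) -
      (chain_map i (emap k) ?w - ?w))"
    using emap_homologous[OF w] by (simp only: singular_relboundary_diff)
  then have "bd i k (frag_cmul (a + 1) ?w + ?S (k - 1) (transfer k X i ?w))"
    by (simp add: algebra_simps frag_cmul_distrib)
  then obtain N where N: "N > 0" "bd i k (frag_cmul N ?w)"
    using Suc.IH[of "a + 1" ?w] w Suc.prems(1) by auto
  \<comment> \<open>The stabilisation of the boundary \<open>N ?w\<close> bounds; subtracting it
    from \<open>N\<close> times the hypothesis leaves \<open>N * a\<close> times \<open>z\<close>, a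
    positive multiple.\<close>
  have "bd i (Suc k) (frag_cmul N (frag_cmul a z + ?S k ?w) - ?S k (frag_cmul N ?w))"
    using singular_relboundary_cmul[OF Suc.prems(3), of N] bd_stab[OF N(2)]
    by (intro singular_relboundary_diff) simp_all
  then have "bd i (Suc k) (frag_cmul (N * a) z)"
    by (simp add: frag_cmul_distrib2)
  then show ?case using N(1) Suc.prems(1) by (intro exI[of _ "N * a"]) simp
qed

lemma stab_injective_mod_torsion:
  assumes z: "cyc i k z" and "bd i (Suc k) (chain_map i (stab k) z)"
  shows "\<exists>N>0. bd i k (frag_cmul N z)"
proof (rule bd_combination_torsion[of 1])
  have "bd i k (transfer (Suc k) X i (chain_map i (stab k) z))"
    using singular_relboundary_transfer[OF Hausdorff assms(2)] by simp
  then have "bd i k (chain_map i (stab (k - 1)) (transfer k X i z) + chain_map i (emap k) z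
      - (chain_map i (emap k) z - z))"
    using transfer_stab[of i k z] z emap_homologous[OF z]
    by (elim singular_relboundary_diff[rotated]) (simp add: singular_cycle)
  then show "bd i k (frag_cmul 1 z + chain_map i (stab (k - 1)) (transfer k X i z))"
    by (simp add: algebra_simps)
qed (use z in auto)

theorem betti_config_le: "betti i (C k) \<le> betti i (C (Suc k))"
  by (rule betti_le[OF continuous_map_stab stab_injective_mod_torsion])

end

section \<open>Isotopies supported in a chart\<close>

text \<open>The sum norm of the first \<open>n\<close> coordinates. Changing one coordinate changes
  it additively, which keeps the estimates for the explicit isotopies linear.\<close>

definition l1norm :: "nat \<Rightarrow> (nat \<Rightarrow> real) \<Rightarrow> real" where
  "l1norm n x = (\<Sum>i<n. \<bar>x i\<bar>)"

lemma l1norm_nonneg [simp]: "0 \<le> l1norm n x"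
  by (simp add: l1norm_def sum_nonneg)

lemma l1norm_triangle: "l1norm n (\<lambda>i. x i + y i) \<le> l1norm n x + l1norm n y"
  unfolding l1norm_def sum.distrib[symmetric] by (intro sum_mono abs_triangle_ineq)

lemma l1norm_triangle_diff: "l1norm n (\<lambda>i. x i - z i) \<le> l1norm n (\<lambda>i. x i - y i) + l1norm n (\<lambda>i. y i - z i)"
  using l1norm_triangle[of n "\<lambda>i. x i - y i" "\<lambda>i. y i - z i"] by simp

lemma l1norm_scale: "l1norm n (\<lambda>i. a * x i) = \<bar>a\<bar> * l1norm n x"
  by (simp add: l1norm_def abs_mult sum_distrib_left)

lemma l1norm_minus_commute: "l1norm n (\<lambda>i. x i - y i) = l1norm n (\<lambda>i. y i - x i)"
  by (simp add: l1norm_def abs_minus_commute)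

lemma l1norm_eq_0D: "l1norm n x = 0 \<Longrightarrow> i < n \<Longrightarrow> x i = 0"
  by (simp add: l1norm_def sum_nonneg_eq_0_iff)

lemma abs_le_l1norm: "i < n \<Longrightarrow> \<bar>x i\<bar> \<le> l1norm n x"
  unfolding l1norm_def by (rule member_le_sum) auto

lemma continuous_on_l1norm [continuous_intros]:
  "(\<And>i. i < n \<Longrightarrow> continuous_on S (\<lambda>x. f x i)) \<Longrightarrow> continuous_on S (\<lambda>x. l1norm n (f x))"
  unfolding l1norm_def by (intro continuous_intros) auto

section \<open>Euclidean spaces inside the space of sequences and their closed balls\<close>

definition Euclid_set :: "nat \<Rightarrow> (nat \<Rightarrow> real) set" where
  "Euclid_set n = {x. \<forall>i\<ge>n. x i = 0}"

lemma Euclidean_space_eq: "Euclidean_space n = top_of_set (Euclid_set n)"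
  by (simp add: Euclidean_space_def Euclid_set_def euclidean_product_topology)

lemma half_space_eq: "half_space n = top_of_set {x \<in> Euclid_set n. 0 \<le> x 0}"
  by (simp add: half_space_def Euclidean_space_eq subtopology_subtopology Collect_conj_eq)

lemma l1norm_diff_eq_0D:
  assumes "x \<in> Euclid_set n" "y \<in> Euclid_set n" "l1norm n (\<lambda>i. x i - y i) = 0"
  shows "x = y"
proof
  fix i show "x i = y i"
    using assms l1norm_eq_0D[OF assms(3), of i] by (cases "i < n") (auto simp: Euclid_set_def)
qed

lemma continuous_on_coordinate [continuous_intros]:
  "continuous_on S (\<lambda>x::nat \<Rightarrow> real. x i)"
  "continuous_on T (\<lambda>z::'a::topological_space \<times> (nat \<Rightarrow> real). snd z i)"
  by (rule continuous_on_product_then_coordinatewise, intro continuous_on_id continuous_on_snd)+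

text \<open>The norm bounds each coordinate below \<open>n\<close>, and the others are 0, so the
  ball is a closed subset of a product of compact intervals.\<close>

lemma compact_l1_ball:
  assumes "c \<in> Euclid_set n"
  shows "compact {x \<in> Euclid_set n. l1norm n (\<lambda>i. x i - c i) \<le> r}"
proof -
  define B where "B = Pi\<^sub>E UNIV (\<lambda>i. {c i - \<bar>r\<bar>..c i + \<bar>r\<bar>})"
  have "compactin (powertop_real UNIV) B"
    unfolding B_def by (simp add: compactin_PiE)
  then have "compact B" by (simp add: euclidean_product_topology)
  moreover have "{x \<in> Euclid_set n. l1norm n (\<lambda>i. x i - c i) \<le> r} =
      B \<inter> ((\<Inter>i\<in>{n..}. {x. x i = 0}) \<inter> {x. l1norm n (\<lambda>i. x i - c i) \<le> r})"
  proof -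
    have "x i \<in> {c i - \<bar>r\<bar>..c i + \<bar>r\<bar>}"
      if "x \<in> Euclid_set n" "l1norm n (\<lambda>i. x i - c i) \<le> r" for x i
      using that assms abs_le_l1norm[of i n "\<lambda>i. x i - c i"]
      by (cases "i < n") (auto simp: Euclid_set_def)
    then show ?thesis by (auto simp: B_def Euclid_set_def PiE_iff)
  qed
  moreover have "closed {x::nat \<Rightarrow> real. x i = 0}" for i
    by (intro closed_Collect_eq continuous_intros)
  moreover have "closed {x::nat \<Rightarrow> real. l1norm n (\<lambda>i. x i - c i) \<le> r}"
    by (intro closed_Collect_le continuous_intros)
  ultimately show ?thesis by (auto intro!: compact_Int_closed closed_Int closed_INT)
qed

lemma openin_contains_l1_ball:
  assumes W: "openin (top_of_set E) W" "w \<in> W" and E: "E \<subseteq> Euclid_set n"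
  obtains r where "r > 0" "\<And>y. y \<in> E \<Longrightarrow> l1norm n (\<lambda>i. y i - w i) \<le> r \<Longrightarrow> y \<in> W"
proof -
  obtain O' where O': "open O'" "W = E \<inter> O'" using W(1) by (auto simp: openin_open)
  obtain r where r: "r > 0" "\<And>x. (\<And>i. i \<in> {..<n} \<Longrightarrow> \<bar>x i - w i\<bar> \<le> r) \<Longrightarrow>
      (\<And>i. i \<notin> {..<n} \<Longrightarrow> x i = w i) \<Longrightarrow> x \<in> O'"
    using open_contains_coordinate_box[OF O'(1), of w "{..<n}"] W(2) O'(2) by auto
  show ?thesis
  proof
    fix y assume y: "y \<in> E" "l1norm n (\<lambda>i. y i - w i) \<le> r"
    have "y \<in> O'"
    proof (rule r(2))
      show "\<bar>y i - w i\<bar> \<le> r" if "i \<in> {..<n}" for i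
        using abs_le_l1norm[of i n "\<lambda>i. y i - w i"] y(2) that by auto
      show "y i = w i" if "i \<notin> {..<n}" for i
      proof -
        have "y \<in> Euclid_set n" "w \<in> Euclid_set n" using y(1) W(2) O'(2) E by auto
        then show ?thesis using that by (simp add: Euclid_set_def)
      qed
    qed
    then show "y \<in> W" using y(1) O'(2) by blast
  qed (rule r(1))
qed

text \<open>The image of \<open>A\<close> under \<open>\<psi>\<close> is compact, hence closed in
  the Hausdorff \<open>M\<close>. So \<open>V\<close> and the complement of this image are open and
  cover \<open>M\<close>, and the chart isotopy agrees with the constant one where they overlap.
  \<open>A\<close> is compact in \<open>W\<close>, not necessarily contained in \<open>D\<close>: it
  may reach into the part of the chart outside \<open>S\<close>.\<close>

lemma isotopy_extend_from_chart:
  fixes M :: "'a topology" and G :: "real \<times> (nat \<Rightarrow> real) \<Rightarrow> nat \<Rightarrow> real"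
  assumes M: "Hausdorff_space M" and S: "S \<subseteq> topspace M" and V: "openin M V"
    and chart: "homeomorphic_maps (subtopology M V) (top_of_set W) \<phi> \<psi>"
    and A: "compact A" "A \<subseteq> W"
    and D: "D = \<phi> ` (V \<inter> S)"
    and G: "continuous_on ({0..1} \<times> D) G" "G \<in> {0..1} \<times> D \<rightarrow> D"
    and inj: "\<And>t. t \<in> {0..1} \<Longrightarrow> inj_on (\<lambda>y. G (t, y)) D"
    and G0: "\<And>y. y \<in> D \<Longrightarrow> G (0, y) = y"
    and GA: "\<And>t y. t \<in> {0..1} \<Longrightarrow> y \<in> D \<Longrightarrow> y \<notin> A \<Longrightarrow> G (t, y) = y"
    and p: "p \<in> D" "p \<notin> (\<lambda>y. G (1, y)) ` D"
  obtains e q where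
    "homotopic_with (\<lambda>f. inj_on f (topspace (subtopology M S))) (subtopology M S) (subtopology M S) id e"
    "q \<in> topspace (subtopology M S)" "q \<notin> e ` topspace (subtopology M S)"
proof -
  let ?X = "subtopology M S" and ?I = "top_of_set {0..1::real}"
  have tX: "topspace ?X = S" using S by auto
  have VM: "V \<subseteq> topspace M" using V openin_subset by blast
  have \<phi>: "continuous_map (subtopology M V) (top_of_set W) \<phi>"
    and \<psi>: "continuous_map (top_of_set W) (subtopology M V) \<psi>"
    and \<psi>\<phi>: "\<And>x. x \<in> V \<Longrightarrow> \<psi> (\<phi> x) = x" and \<phi>\<psi>: "\<And>y. y \<in> W \<Longrightarrow> \<phi> (\<psi> y) = y"
    and \<psi>V: "\<And>y. y \<in> W \<Longrightarrow> \<psi> y \<in> V" and \<phi>W: "\<And>x. x \<in> V \<Longrightarrow> \<phi> x \<in> W"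
    using chart VM by (auto simp: homeomorphic_maps_def continuous_map_def)
  have DW: "D \<subseteq> W" using D \<phi>W by auto
  have \<psi>D: "\<psi> y \<in> V \<inter> S" if "y \<in> D" for y using that D \<psi>\<phi> by auto
  have \<phi>D: "\<phi> x \<in> D" if "x \<in> V" "x \<in> S" for x using that D by auto
  have GD: "G (t, y) \<in> D" if "t \<in> {0..1}" "y \<in> D" for t y using G(2) that by auto
  define h where "h = (\<lambda>(t, x). if x \<in> V \<inter> S then \<psi> (G (t, \<phi> x)) else x)"
  have "compactin (top_of_set W) A" using A by (simp add: compactin_subtopology)
  then have "compactin (subtopology M V) (\<psi> ` A)" using \<psi> by (rule image_compactin)
  then have "closedin M (\<psi> ` A)"
    using M by (intro compactin_imp_closedin) (auto simp: compactin_subtopology)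
  then have openA: "openin M (topspace M - \<psi> ` A)" by auto
  have conth: "continuous_map (prod_topology ?I ?X) ?X h"
  proof (rule pasting_lemma[where I = UNIV and T = "\<lambda>b. {0..1} \<times> (S \<inter> (if b then V else topspace M - \<psi> ` A))"
        and f = "\<lambda>b. if b then (\<lambda>(t, x). \<psi> (G (t, \<phi> x))) else snd"])
    show "openin (prod_topology ?I ?X) ({0..1} \<times> (S \<inter> (if b then V else topspace M - \<psi> ` A)))" for b
      using V openA unfolding openin_prod_Times_iff
      by (auto simp: openin_subtopology Int_commute intro: exI[of _ V] exI[of _ "topspace M - \<psi> ` A"])
  next
    fix b :: bool
    show "continuous_map (subtopology (prod_topology ?I ?X) ({0..1} \<times> (S \<inter> (if b then V else topspace M - \<psi> ` A)))) ?X
       (if b then (\<lambda>(t, x). \<psi> (G (t, \<phi> x))) else snd)"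
    proof (cases b)
      case True
      let ?Y = "subtopology (prod_topology ?I ?X) ({0..1} \<times> (S \<inter> V))"
      have Y: "?Y = prod_topology ?I (subtopology M (S \<inter> V))"
        by (simp add: prod_topology_subtopology subtopology_subtopology Times_Int_Times Int_assoc)
      have "continuous_map (subtopology M (S \<inter> V)) (top_of_set D) \<phi>"
        using \<phi> \<phi>D DW by (auto simp: continuous_map_in_subtopology intro: continuous_map_from_subtopology_mono)
      then have "continuous_map ?Y (prod_topology ?I (top_of_set D)) (\<lambda>(t, x). (t, \<phi> x))"
        unfolding Y by (simp add: continuous_map_prod_top del: prod_topology_subtopology_eu)
      moreover have "continuous_map (prod_topology ?I (top_of_set D)) (top_of_set D) G"
        using G by (auto simp: continuous_map_in_subtopology)
      moreover have "continuous_map (top_of_set D) ?X \<psi>"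
        using \<psi> \<psi>D DW by (auto simp: continuous_map_in_subtopology intro: continuous_map_from_subtopology_mono)
      ultimately have "continuous_map ?Y ?X (\<psi> \<circ> (G \<circ> (\<lambda>(t, x). (t, \<phi> x))))"
        by (intro continuous_map_compose)
      then show ?thesis using True by (simp add: o_def case_prod_unfold)
    next
      case False
      then show ?thesis by (auto intro!: continuous_map_from_subtopology continuous_map_snd)
    qed
  next
    fix b c :: bool and z
    assume z: "z \<in> topspace (prod_topology ?I ?X) \<inter> {0..1} \<times> (S \<inter> (if b then V else topspace M - \<psi> ` A)) \<inter>
         {0..1} \<times> (S \<inter> (if c then V else topspace M - \<psi> ` A))"
    obtain t x where tx: "z = (t, x)" by force
    have "\<psi> (G (t, \<phi> x)) = x" if "t \<in> {0..1}" "x \<in> S" "x \<in> V" "x \<notin> \<psi> ` A"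
    proof -
      have "\<phi> x \<notin> A" using that \<psi>\<phi> by force
      then show ?thesis using GA[OF that(1) \<phi>D] that \<psi>\<phi> by simp
    qed
    then show "(if b then \<lambda>(t, x). \<psi> (G (t, \<phi> x)) else snd) z = (if c then \<lambda>(t, x). \<psi> (G (t, \<phi> x)) else snd) z"
      using z by (cases b; cases c) (auto simp: tx)
  next
    fix z assume "z \<in> topspace (prod_topology ?I ?X)"
    then obtain t x where tx: "z = (t, x)" "t \<in> {0..1}" "x \<in> S" using tX by auto
    have "\<psi> ` A \<subseteq> V" using A(2) \<psi>V by auto
    then show "\<exists>j. j \<in> UNIV \<and> z \<in> {0..1} \<times> (S \<inter> (if j then V else topspace M - \<psi> ` A)) \<and>
          h z = (if j then \<lambda>(t, x). \<psi> (G (t, \<phi> x)) else snd) z"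
      using tx S by (intro exI[of _ "x \<in> V"]) (auto simp: h_def)
  qed
  \<comment> \<open>Every stage preserves both \<open>V\<close> and its complement, so only points
    in the same part have to be compared.\<close>
  have injh: "inj_on (\<lambda>x. h (t, x)) S" if t: "t \<in> {0..1}" for t
  proof (rule inj_onI)
    fix x y assume xy: "x \<in> S" "y \<in> S" "h (t, x) = h (t, y)"
    have inV: "h (t, x) \<in> V \<longleftrightarrow> x \<in> V" if "x \<in> S" for x
      using \<psi>D[OF GD[OF t \<phi>D[OF _ that]]] that by (auto simp: h_def)
    show "x = y"
    proof (cases "x \<in> V")
      case True
      then have y: "y \<in> V" using inV xy by metis
      have "\<psi> (G (t, \<phi> x)) = \<psi> (G (t, \<phi> y))" using xy True y by (simp add: h_def)
      then have "G (t, \<phi> x) = G (t, \<phi> y)"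
        using \<phi>\<psi> DW GD[OF t \<phi>D[OF True xy(1)]] GD[OF t \<phi>D[OF y xy(2)]] by (metis subsetD)
      then have "\<phi> x = \<phi> y" using inj[OF t] \<phi>D True y xy by (auto dest: inj_onD)
      then show ?thesis using \<psi>\<phi> True y by metis
    next
      case False
      then have "y \<notin> V" using inV xy by metis
      then show ?thesis using xy False by (simp add: h_def)
    qed
  qed
  have h0: "h (0, x) = x" for x using G0 \<phi>D \<psi>\<phi> by (auto simp: h_def)
  show ?thesis
  proof
    show "homotopic_with (\<lambda>f. inj_on f (topspace ?X)) ?X ?X id (\<lambda>x. h (1, x))"
      unfolding homotopic_with_def tX using conth injh h0 by (intro exI[of _ h]) auto
    show "\<psi> p \<in> topspace ?X" using \<psi>D[OF p(1)] tX by auto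
    show "\<psi> p \<notin> (\<lambda>x. h (1, x)) ` topspace ?X"
    proof
      assume "\<psi> p \<in> (\<lambda>x. h (1, x)) ` topspace ?X"
      then obtain x where x: "x \<in> S" "\<psi> p = h (1, x)" using tX by auto
      have "x \<in> V"
        using x \<psi>D[OF p(1)] by (auto simp: h_def split: if_splits)
      then have "\<psi> p = \<psi> (G (1, \<phi> x))" using x by (simp add: h_def)
      then have "p = G (1, \<phi> x)"
        using \<phi>\<psi> DW p(1) GD[OF _ \<phi>D[OF \<open>x \<in> V\<close> x(1)], of 1] by (metis atLeastAtMost_iff subsetD zero_le_one order_refl)
      then show False using p(2) \<phi>D[OF \<open>x \<in> V\<close> x(1)] by auto
    qed
  qed
qed

section \<open>Pushing in from the boundary\<close>

lemma locally_modelled_at_obtain: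
  assumes "locally_modelled_at M (top_of_set E) x"
  obtains V W \<phi> \<psi> where "openin M V" "x \<in> V" "openin (top_of_set E) W"
    "homeomorphic_maps (subtopology M V) (top_of_set W) \<phi> \<psi>"
proof -
  obtain V W where VW: "openin M V" "x \<in> V" "openin (top_of_set E) W"
      "subtopology M V homeomorphic_space subtopology (top_of_set E) W"
    using assms unfolding locally_modelled_at_def by blast
  moreover have "subtopology (top_of_set E) W = top_of_set W"
    using openin_subset[OF VW(3)] by (simp add: subtopology_subtopology inf.absorb2)
  ultimately show ?thesis using that unfolding homeomorphic_space_def by auto
qed

lemma homeomorphic_maps_restrict_open:
  assumes V: "openin M V" and chart: "homeomorphic_maps (subtopology M V) (top_of_set W) \<phi> \<psi>"
    and W': "openin (top_of_set W) W'"
  shows "openin M {x \<in> V. \<phi> x \<in> W'}"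
    "homeomorphic_maps (subtopology M {x \<in> V. \<phi> x \<in> W'}) (top_of_set W') \<phi> \<psi>"
proof -
  have VM: "V \<subseteq> topspace M" using V openin_subset by blast
  have W'W: "W' \<subseteq> W" using openin_subset[OF W'] by simp
  have "continuous_map (subtopology M V) (top_of_set W) \<phi>" using chart by (simp add: homeomorphic_maps_def)
  from openin_continuous_map_preimage[OF this W'] have "openin (subtopology M V) {x \<in> V. \<phi> x \<in> W'}"
    using VM by (simp add: inf.absorb2)
  then show "openin M {x \<in> V. \<phi> x \<in> W'}" using V openin_trans_full by blast
  have "\<phi> ` (topspace (subtopology M V) \<inter> {x \<in> V. \<phi> x \<in> W'}) = topspace (top_of_set W) \<inter> W'"
  proof
    show "topspace (top_of_set W) \<inter> W' \<subseteq> \<phi> ` (topspace (subtopology M V) \<inter> {x \<in> V. \<phi> x \<in> W'})"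
    proof
      fix y assume y: "y \<in> topspace (top_of_set W) \<inter> W'"
      then have "\<psi> y \<in> V" "\<phi> (\<psi> y) = y" using chart VM by (auto simp: homeomorphic_maps_def continuous_map_def)
      then show "y \<in> \<phi> ` (topspace (subtopology M V) \<inter> {x \<in> V. \<phi> x \<in> W'})"
        using y VM by (intro image_eqI[of _ _ "\<psi> y"]) auto
    qed
  qed (use W'W in auto)
  from homeomorphic_maps_subtopologies[OF chart this]
  show "homeomorphic_maps (subtopology M {x \<in> V. \<phi> x \<in> W'}) (top_of_set W') \<phi> \<psi>"
    using W'W by (simp add: subtopology_subtopology inf.absorb2 Collect_conj_eq flip: Int_assoc)
qed

text \<open>If the first coordinate at \<open>b\<close> were positive, restricting the chart to
  positive first coordinates would give a Euclidean chart, and \<open>b\<close> would be interior.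
  For \<open>n = 0\<close> the half-space is the Euclidean space, so there is no boundary.\<close>

lemma manifold_boundary_chart:
  assumes M: "manifold_with_boundary n M" and b: "b \<in> manifold_boundary n M"
    and V: "openin M V" "b \<in> V" and W: "openin (half_space n) W"
    and chart: "homeomorphic_maps (subtopology M V) (top_of_set W) \<phi> \<psi>"
  shows "\<phi> b 0 = 0" "0 < n"
proof -
  have VM: "V \<subseteq> topspace M" using V openin_subset by blast
  have W': "W \<subseteq> {x \<in> Euclid_set n. 0 \<le> x 0}" using openin_subset[OF W] by (simp add: half_space_eq)
  have \<phi>b: "\<phi> b \<in> W" using chart V VM by (auto simp: homeomorphic_maps_def continuous_map_def)
  have notint: "\<not> locally_modelled_at M (Euclidean_space n) b"
    using b VM V by (auto simp: manifold_boundary_def manifold_interior_def)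
  show "0 < n"
  proof (rule ccontr)
    assume "\<not> 0 < n"
    then have "half_space n = Euclidean_space n"
      unfolding half_space_eq Euclidean_space_eq by (intro arg_cong[of _ _ top_of_set]) (auto simp: Euclid_set_def)
    then show False
      using M notint VM V(2) by (auto simp: manifold_with_boundary_def)
  qed
  show "\<phi> b 0 = 0"
  proof (rule ccontr)
    assume "\<phi> b 0 \<noteq> 0"
    then have pos: "0 < \<phi> b 0" using \<phi>b W' by force
    obtain O' where O': "open O'" "W = {x \<in> Euclid_set n. 0 \<le> x 0} \<inter> O'"
      using W unfolding half_space_eq openin_open by blast
    have o: "open {x::nat \<Rightarrow> real. 0 < x 0}" by (intro open_Collect_less continuous_intros)
    define W1 where "W1 = W \<inter> {x. 0 < x 0}"
    have "openin (top_of_set W) W1" unfolding W1_def using o by (simp add: openin_open_Int)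
    note restr = homeomorphic_maps_restrict_open[OF V(1) chart this]
    have "W1 = Euclid_set n \<inter> (O' \<inter> {x. 0 < x 0})" unfolding W1_def O'(2) by auto
    then have "openin (Euclidean_space n) W1"
      unfolding Euclidean_space_eq using O'(1) o by (simp add: openin_open_Int open_Int)
    moreover have "subtopology (Euclidean_space n) W1 = top_of_set W1"
      using W' by (simp add: Euclidean_space_eq subtopology_subtopology W1_def inf.absorb2 subset_iff)
    moreover have "b \<in> {x \<in> V. \<phi> x \<in> W1}" using V \<phi>b pos by (auto simp: W1_def)
    ultimately have "locally_modelled_at M (Euclidean_space n) b"
      unfolding locally_modelled_at_def homeomorphic_space_def using restr by metis
    then show False using notint by blast
  qed
qed

text \<open>Near \<open>b\<close>, points are pushed inwards along the first coordinate by half of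
  \<open>\<epsilon> - \<nu> y\<close>. The factor one half makes the displacement a contraction in
  that coordinate, so the push is injective; \<open>b\<close> is uncovered because no point lies
  below it.\<close>

lemma push_off_boundary:
  assumes M: "manifold_with_boundary n M" and U: "closedin M U"
    and b: "b \<in> manifold_boundary n M" "b \<notin> U"
  obtains e q where
    "homotopic_with (\<lambda>f. inj_on f (topspace (subtopology M (topspace M - U))))
       (subtopology M (topspace M - U)) (subtopology M (topspace M - U)) id e"
    "q \<in> topspace (subtopology M (topspace M - U))" "q \<notin> e ` topspace (subtopology M (topspace M - U))"
proof -
  let ?H = "{x \<in> Euclid_set n. 0 \<le> x 0}"
  have bM: "b \<in> topspace M" using b by (simp add: manifold_boundary_def)
  then have "locally_modelled_at M (top_of_set ?H) b"
    using M unfolding manifold_with_boundary_def half_space_eq by blast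
  then obtain V0 W0 \<phi> \<psi> where V0: "openin M V0" "b \<in> V0" and W0: "openin (top_of_set ?H) W0"
      and chart0: "homeomorphic_maps (subtopology M V0) (top_of_set W0) \<phi> \<psi>"
    by (rule locally_modelled_at_obtain)
  have V0M: "V0 \<subseteq> topspace M" using V0 openin_subset by blast
  define w where "w = \<phi> b"
  have w0: "w 0 = 0" and n: "0 < n"
    using manifold_boundary_chart[OF M b(1) V0 _ chart0] W0 by (simp_all add: half_space_eq w_def)
  \<comment> \<open>Removing \<open>U\<close> from the chart domain lets the isotopy act on the
    whole image \<open>W\<close>.\<close>
  define V where "V = V0 - U"
  define W where "W = \<phi> ` V"
  have V: "openin M V" "b \<in> V" unfolding V_def using V0 U b by auto
  have hm: "homeomorphic_map (subtopology M V0) (top_of_set W0) \<phi>"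
    using chart0 homeomorphic_maps_map by blast
  have "openin (subtopology M V0) V" using V(1) unfolding V_def
    by (simp add: openin_open_subtopology[OF V0(1)] Diff_subset)
  then have "openin (top_of_set W0) W"
    using homeomorphic_map_openness[OF hm, of V] V0M unfolding W_def by (auto simp: V_def)
  then have W: "openin (top_of_set ?H) W" using W0 openin_trans by blast
  have WH: "W \<subseteq> ?H" using openin_subset[OF W] by simp
  have chart: "homeomorphic_maps (subtopology M V) (top_of_set W) \<phi> \<psi>"
  proof -
    have "W \<subseteq> W0" using \<open>openin (top_of_set W0) W\<close> openin_subset by fastforce
    then show ?thesis
      using homeomorphic_maps_subtopologies[OF chart0, of V W] V0M
      by (simp add: W_def subtopology_subtopology inf.absorb2 V_def Int_absorb1 Diff_subset subset_iff)
  qed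
  have wW: "w \<in> W" using V by (auto simp: W_def w_def)
  have wE: "w \<in> Euclid_set n" using wW WH by auto
  obtain r where r: "r > 0" "\<And>y. y \<in> ?H \<Longrightarrow> l1norm n (\<lambda>i. y i - w i) \<le> r \<Longrightarrow> y \<in> W"
    using openin_contains_l1_ball[OF W wW, of n] by auto
  \<comment> \<open>Points within \<open>\<epsilon>\<close> of \<open>w\<close> move by at most
    \<open>\<epsilon> / 2\<close>, so they stay within the radius \<open>r\<close> on which
    \<open>W\<close> fills the half-space.\<close>
  define \<epsilon> where "\<epsilon> = r / 2"
  have \<epsilon>: "\<epsilon> > 0" using r by (simp add: \<epsilon>_def)
  define \<nu> where "\<nu> y = l1norm n (\<lambda>i. y i - w i)" for y
  define G where "G = (\<lambda>(t::real, y). y(0 := y 0 + t * (max 0 (\<epsilon> - \<nu> y) / 2)))"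
  define A where "A = {y \<in> ?H. \<nu> y \<le> \<epsilon>}"
  \<comment> \<open>As \<open>w\<close> has first coordinate 0, the distance to \<open>w\<close>
    changes exactly by the change of \<open>\<bar>y 0\<bar>\<close>.\<close>
  have \<nu>_upd: "\<nu> (y(0 := a)) = \<bar>a\<bar> + (\<nu> y - \<bar>y 0\<bar>)" for y a
  proof -
    have "{..<n} = insert 0 {1..<n}" using n by auto
    then show ?thesis unfolding \<nu>_def l1norm_def using w0 by simp
  qed
  have GW: "G (t, y) \<in> W" if t: "t \<in> {0..1}" and y: "y \<in> W" for t y
  proof (cases "\<nu> y \<le> \<epsilon>")
    case True
    have "y \<in> ?H" using y WH by auto
    have "0 \<le> \<nu> y" by (simp add: \<nu>_def)
    then have "t * (max 0 (\<epsilon> - \<nu> y) / 2) \<le> 1 * (\<epsilon> / 2)"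
      using t \<epsilon> by (intro mult_mono) auto
    moreover have "0 \<le> t * (max 0 (\<epsilon> - \<nu> y) / 2)" using t by auto
    ultimately have m: "0 \<le> t * (max 0 (\<epsilon> - \<nu> y) / 2)" "t * (max 0 (\<epsilon> - \<nu> y) / 2) \<le> \<epsilon> / 2" by simp_all
    have "G (t, y) \<in> ?H" using \<open>y \<in> ?H\<close> n m by (auto simp: G_def Euclid_set_def)
    moreover have "\<nu> (G (t, y)) \<le> r"
      using m True \<open>y \<in> ?H\<close> by (simp add: G_def \<nu>_upd \<epsilon>_def)
    ultimately show ?thesis using r(2) by (simp add: \<nu>_def)
  qed (use y in \<open>simp add: G_def\<close>)
  show ?thesis
  proof (rule isotopy_extend_from_chart[OF _ _ V(1) chart, of "topspace M - U" A W G w])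
    show "Hausdorff_space M" using M by (simp add: manifold_with_boundary_def)
    show "compact A"
    proof -
      have "closed {x::nat \<Rightarrow> real. 0 \<le> x 0}" by (intro closed_Collect_le continuous_intros)
      moreover have "A = {y \<in> Euclid_set n. l1norm n (\<lambda>i. y i - w i) \<le> \<epsilon>} \<inter> {x. 0 \<le> x 0}"
        by (auto simp: A_def \<nu>_def)
      ultimately show ?thesis by (simp add: compact_Int_closed[OF compact_l1_ball[OF wE]])
    qed
    show "A \<subseteq> W" using r \<epsilon> by (auto simp: A_def \<nu>_def \<epsilon>_def)
    show "W = \<phi> ` (V \<inter> (topspace M - U))" using V0M by (auto simp: W_def V_def)
    show "continuous_on ({0..1} \<times> W) G"
      unfolding G_def case_prod_unfold \<nu>_def
    proof (rule continuous_on_coordinatewise_then_product)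
      fix i
      show "continuous_on ({0..1} \<times> W)
         (\<lambda>x. ((snd x)(0 := snd x 0 + fst x * (max 0 (\<epsilon> - l1norm n (\<lambda>i. snd x i - w i)) / 2))) i)"
        by (cases "i = 0") (auto intro!: continuous_intros)
    qed
    show "G \<in> {0..1} \<times> W \<rightarrow> W" using GW by auto
    show "inj_on (\<lambda>y. G (t, y)) W" if t: "t \<in> {0..1}" for t
    proof (rule inj_onI)
      fix x y assume xy: "x \<in> W" "y \<in> W" "G (t, x) = G (t, y)"
      have i: "x i = y i" if "i \<noteq> 0" for i using fun_cong[OF xy(3), of i] that by (simp add: G_def)
      then have "y = x(0 := y 0)" by auto
      have nonneg: "0 \<le> x 0" "0 \<le> y 0" using xy(1,2) WH by auto
      have \<nu>: "\<nu> y = y 0 + (\<nu> x - x 0)" using \<nu>_upd[of x "y 0"] nonneg \<open>y = x(0 := y 0)\<close> by simp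
      have eq: "x 0 + t * (max 0 (\<epsilon> - \<nu> x) / 2) = y 0 + t * (max 0 (\<epsilon> - \<nu> y) / 2)"
        using fun_cong[OF xy(3), of 0] by (simp add: G_def)
      have "x 0 - y 0 = t * ((max 0 (\<epsilon> - \<nu> y) - max 0 (\<epsilon> - \<nu> x)) / 2)"
        using eq by (simp add: algebra_simps diff_divide_distrib)
      then have "\<bar>x 0 - y 0\<bar> = \<bar>t * ((max 0 (\<epsilon> - \<nu> y) - max 0 (\<epsilon> - \<nu> x)) / 2)\<bar>"
        by (rule arg_cong)
      also have "\<dots> = t * (\<bar>max 0 (\<epsilon> - \<nu> y) - max 0 (\<epsilon> - \<nu> x)\<bar> / 2)"
        using t by (simp add: abs_mult)
      \<comment> \<open>Here \<open>x\<close> and \<open>y\<close> differ only in a nonnegative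
        first coordinate, so \<open>\<nu>\<close> differs as much as that coordinate, and truncation
        at 0 does not increase the difference.\<close>
      also have "\<dots> \<le> 1 * (\<bar>x 0 - y 0\<bar> / 2)"
        using t \<nu> by (intro mult_mono) auto
      finally have "x 0 = y 0" by simp
      then show "x = y" using \<open>y = x(0 := y 0)\<close> by (metis fun_upd_triv)
    qed
    show "G (0, y) = y" for y by (simp add: G_def)
    show "G (t, y) = y" if "y \<in> W" "y \<notin> A" for t y
      using that WH by (auto simp: G_def A_def max_def)
    show "w \<in> W" by (rule wW)
    show "w \<notin> (\<lambda>y. G (1, y)) ` W"
    proof
      assume "w \<in> (\<lambda>y. G (1, y)) ` W"
      then obtain y where y: "y \<in> W" "w = G (1, y)" by auto
      have y0: "0 \<le> y 0" using y WH by auto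
      \<comment> \<open>Both summands are nonnegative, so both vanish and \<open>y\<close> has not
        moved; but then \<open>y = w\<close>, where the push is
        \<open>\<epsilon> / 2\<close>.\<close>
      have sum0: "y 0 + max 0 (\<epsilon> - \<nu> y) / 2 = 0" using w0 y(2) by (simp add: G_def)
      then have "y 0 = 0 \<and> max 0 (\<epsilon> - \<nu> y) / 2 = 0"
        using y0 add_nonneg_eq_0_iff[of "y 0" "max 0 (\<epsilon> - \<nu> y) / 2"] by simp
      then have "max 0 (\<epsilon> - \<nu> y) = 0" by simp
      then have "\<epsilon> \<le> \<nu> y" by linarith
      then have "G (1, y) = y" using \<open>max 0 (\<epsilon> - \<nu> y) = 0\<close> by (simp add: G_def)
      then have "w = y" using y(2) by simp
      then have "\<nu> y = 0" by (simp add: \<nu>_def l1norm_def)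
      then show False using \<open>\<epsilon> \<le> \<nu> y\<close> \<epsilon> by simp
    qed
  qed (use that in auto)
qed

section \<open>Pushing in from a puncture\<close>

text \<open>The cone over the ball of radius \<open>r / 2\<close> around \<open>c + v\<close> is compressed radially towards its base.\<close>

lemma cone_compression:
  fixes D :: "(nat \<Rightarrow> real) set"
  assumes D: "D \<subseteq> Euclid_set n" "c \<notin> D" and c: "c \<in> Euclid_set n"
    and v: "v \<in> Euclid_set n" "l1norm n v = r" "r > 0"
    and cone: "\<And>s d. 0 < s \<Longrightarrow> s \<le> 1 \<Longrightarrow> d \<in> Euclid_set n \<Longrightarrow> l1norm n d \<le> r / 2 \<Longrightarrow>
                 (\<lambda>i. c i + s * (v i + d i)) \<in> D"
  obtains G :: "real \<times> (nat \<Rightarrow> real) \<Rightarrow> nat \<Rightarrow> real" and p where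
    "continuous_on ({0..1} \<times> D) G" "G \<in> {0..1} \<times> D \<rightarrow> D"
    "\<And>t. t \<in> {0..1} \<Longrightarrow> inj_on (\<lambda>y. G (t, y)) D"
    "\<And>y. y \<in> D \<Longrightarrow> G (0, y) = y"
    "\<And>t y. y \<in> D \<Longrightarrow> r < l1norm n (\<lambda>i. y i - c i) \<Longrightarrow> G (t, y) = y"
    "p \<in> D" "p \<notin> (\<lambda>y. G (1, y)) ` D"
proof -
  define \<nu> where "\<nu> y = l1norm n (\<lambda>i. y i - c i)" for y
  \<comment> \<open>\<open>dir y\<close> projects \<open>y - c\<close> radially to the sphere of
    radius \<open>r\<close>. \<open>cut\<close> depends on it alone: it is 1 in the direction
    \<open>v\<close> and 0 for directions at distance \<open>r / 2\<close> or more.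
    \<open>stretch\<close> keeps the direction and turns a radius \<open>\<nu> \<le> r\<close> into
    \<open>\<nu> + t * cut / 2 * (r - \<nu>)\<close>.\<close>
  define dir where "dir y = (\<lambda>i. r / \<nu> y * (y i - c i))" for y
  define cut where "cut y = max 0 (1 - 2 / r * l1norm n (\<lambda>i. dir y i - v i))" for y
  define stretch where "stretch t y = 1 + t * cut y * max 0 (r - \<nu> y) / (2 * \<nu> y)" for t y
  define G where "G = (\<lambda>(t, y) i. c i + stretch t y * (y i - c i))"
  have \<nu>_pos: "0 < \<nu> y" if "y \<in> D" for y
  proof -
    have "\<nu> y \<noteq> 0"
      using l1norm_diff_eq_0D[of y n c] that D c by (auto simp: \<nu>_def)
    moreover have "0 \<le> \<nu> y" by (simp add: \<nu>_def)
    ultimately show ?thesis by simp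
  qed
  have cut: "0 \<le> cut y" "cut y \<le> 1" for y
    using v(3) by (auto simp: cut_def)
  have stretch_pos: "1 \<le> stretch t y" if "t \<in> {0..1}" "y \<in> D" for t y
    unfolding stretch_def using that cut[of y] \<nu>_pos[OF that(2)] by simp
  have \<nu>_scale: "\<nu> (\<lambda>i. c i + a * (y i - c i)) = \<bar>a\<bar> * \<nu> y" for a y
    by (simp add: \<nu>_def l1norm_scale)
  have dir_scale: "dir (\<lambda>i. c i + a * (y i - c i)) = dir y" if "a > 0" for a y
    using that by (simp add: dir_def \<nu>_scale)
  have \<nu>G: "\<nu> (G (t, y)) = \<nu> y + t * cut y / 2 * max 0 (r - \<nu> y)" if "t \<in> {0..1}" "y \<in> D" for t y
    using stretch_pos[OF that] \<nu>_pos[OF that(2)] by (simp add: G_def \<nu>_scale) (simp add: stretch_def field_simps)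
  have dirG: "dir (G (t, y)) = dir y" if "t \<in> {0..1}" "y \<in> D" for t y
    using stretch_pos[OF that] dir_scale[of "stretch t y" y] by (simp add: G_def)
  have recover: "y = (\<lambda>i. c i + \<nu> y / r * dir y i)" if "y \<in> D" for y
    using \<nu>_pos[OF that] v(3) by (auto simp: dir_def)
  have GD: "G (t, y) \<in> D" if t: "t \<in> {0..1}" and y: "y \<in> D" for t y
  proof (cases "cut y = 0 \<or> r \<le> \<nu> y")
    case True
    then have "G (t, y) = y" by (auto simp: G_def stretch_def)
    then show ?thesis using y by simp
  next
    case False
    let ?d = "\<lambda>i. dir y i - v i" and ?s = "stretch t y * \<nu> y / r"
    have "t * cut y / 2 * max 0 (r - \<nu> y) \<le> 1 * max 0 (r - \<nu> y)"
      using t cut[of y] mult_mono[of t 1 "cut y" 1] by (intro mult_right_mono) auto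
    then have le: "stretch t y * \<nu> y \<le> r"
      using \<nu>G[OF t y] stretch_pos[OF t y] False by (simp add: G_def \<nu>_scale)
    \<comment> \<open>A moved point has nonzero \<open>cut\<close>, so its direction is within
      \<open>r / 2\<close> of \<open>v\<close>, and its new radius is at most \<open>r\<close>: it
      lies in the cone.\<close>
    have "(\<lambda>i. c i + ?s * (v i + ?d i)) \<in> D"
    proof (rule cone)
      show "0 < ?s" "?s \<le> 1" using le stretch_pos[OF t y] \<nu>_pos[OF y] v(3) by simp_all
      show "?d \<in> Euclid_set n" using y D v(1) c by (auto simp: Euclid_set_def dir_def)
      show "l1norm n ?d \<le> r / 2" using False v(3) by (auto simp: cut_def max_def field_simps split: if_splits)
    qed
    moreover have "(\<lambda>i. c i + ?s * (v i + ?d i)) = G (t, y)"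
      using \<nu>_pos[OF y] v(3) by (auto simp: G_def dir_def)
    ultimately show ?thesis by simp
  qed
  \<comment> \<open>In the direction \<open>v\<close> a radius below \<open>r\<close> becomes
    \<open>(\<nu> + r) / 2 > r / 2\<close> at time 1, so the point at radius \<open>r / 4\<close> is
    missed. The summand 0 matches the hypothesis \<open>cone\<close> with zero
    \<open>d\<close>.\<close>
  define p where "p i = c i + 1 / 4 * (v i + 0)" for i
  show ?thesis
  proof (rule that[of G p])
    have nz: "\<nu> y \<noteq> 0" if "y \<in> D" for y using \<nu>_pos[OF that] by simp
    have cont: "continuous_on ({0..1::real} \<times> D) (\<lambda>z. \<nu> (snd z))"
      unfolding \<nu>_def by (intro continuous_intros)
    have contd: "continuous_on ({0..1::real} \<times> D) (\<lambda>z. dir (snd z) i)" for i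
      unfolding dir_def by (intro continuous_intros cont) (use nz in auto)
    have contcut: "continuous_on ({0..1::real} \<times> D) (\<lambda>z. cut (snd z))"
      unfolding cut_def by (intro continuous_intros contd)
    show "continuous_on ({0..1} \<times> D) G"
      unfolding G_def case_prod_unfold stretch_def
      by (intro continuous_on_coordinatewise_then_product continuous_intros cont contcut) (use nz in auto)
    show "G \<in> {0..1} \<times> D \<rightarrow> D" using GD by auto
    show "inj_on (\<lambda>y. G (t, y)) D" if t: "t \<in> {0..1}" for t
    proof (rule inj_onI)
      fix x y assume xy: "x \<in> D" "y \<in> D" "G (t, x) = G (t, y)"
      have dir: "dir x = dir y" using dirG[OF t xy(1)] dirG[OF t xy(2)] xy(3) by simp
      then have cuteq: "cut x = cut y" by (simp add: cut_def)
      \<comment> \<open>\<open>x\<close> and \<open>y\<close> lie on the same ray, where the radius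
        changes by \<open>a\<close> times a 1-Lipschitz function. As \<open>a\<close> is at most
        1/2, the new radius determines the old one.\<close>
      define a where "a = t * cut y / 2"
      have a: "0 \<le> a" "a < 1"
        using t cut[of y] mult_mono[of t 1 "cut y" 1] by (auto simp: a_def)
      have "\<nu> x + a * max 0 (r - \<nu> x) = \<nu> y + a * max 0 (r - \<nu> y)"
        using \<nu>G[OF t xy(1)] \<nu>G[OF t xy(2)] xy(3) cuteq by (simp add: a_def)
      then have "\<nu> x - \<nu> y = a * (max 0 (r - \<nu> y) - max 0 (r - \<nu> x))" by (simp add: algebra_simps)
      then have "\<bar>\<nu> x - \<nu> y\<bar> = \<bar>a * (max 0 (r - \<nu> y) - max 0 (r - \<nu> x))\<bar>" by (rule arg_cong)
      also have "\<dots> = a * \<bar>max 0 (r - \<nu> y) - max 0 (r - \<nu> x)\<bar>" using a by (simp add: abs_mult)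
      also have "\<dots> \<le> a * \<bar>\<nu> x - \<nu> y\<bar>" using a by (intro mult_left_mono) auto
      finally have "(1 - a) * \<bar>\<nu> x - \<nu> y\<bar> \<le> 0" by (simp add: algebra_simps)
      then have "\<nu> x = \<nu> y" using a by (simp add: mult_le_0_iff)
      then show "x = y" using recover[OF xy(1)] recover[OF xy(2)] dir by simp
    qed
    show "G (0, y) = y" for y by (simp add: G_def stretch_def)
    show "G (t, y) = y" if "r < l1norm n (\<lambda>i. y i - c i)" for t y
      using that by (simp add: G_def stretch_def flip: \<nu>_def)
    show "p \<in> D"
      unfolding p_def by (rule cone[of "1/4" "\<lambda>_. 0"]) (use v(3) in \<open>auto simp: Euclid_set_def l1norm_def\<close>)
    show "p \<notin> (\<lambda>y. G (1, y)) ` D"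
    proof
      assume "p \<in> (\<lambda>y. G (1, y)) ` D"
      then obtain y where y: "y \<in> D" "p = G (1, y)" by auto
      have \<nu>p: "\<nu> p = r / 4" using v by (simp add: \<nu>_def p_def l1norm_scale[of n "1/4", simplified])
      then have "dir p = v" using v(3) by (auto simp: dir_def p_def)
      then have "dir y = v" using dirG[OF _ y(1), of 1] y(2) by simp
      then have "cut y = 1" by (simp add: cut_def l1norm_def)
      then have "r / 4 = \<nu> y + 1 / 2 * max 0 (r - \<nu> y)"
        using \<nu>G[OF _ y(1), of 1] y(2) \<nu>p by simp
      then show False using \<nu>_pos[OF y(1)] v(3) by (auto simp: max_def split: if_splits)
    qed
  qed
qed

text \<open>Since \<open>M\<close> is connected, \<open>U\<close> is not open, so some
  \<open>u\<close> in \<open>U\<close> has points outside \<open>U\<close> in each neighbourhood.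
  For such a point \<open>y0\<close> near \<open>u\<close>, a nearest point \<open>c\<close> of
  \<open>U\<close> in the chart is the apex of the cone to compress; \<open>u\<close> itself need
  not be the apex of a cone in the complement.\<close>

lemma push_off_puncture:
  assumes M: "manifold_with_boundary n M" and conn: "connected_space M" and U: "closedin M U"
    and UM: "U \<noteq> {}" "topspace M - U \<noteq> {}" and int: "U \<subseteq> manifold_interior n M"
  obtains e q where
    "homotopic_with (\<lambda>f. inj_on f (topspace (subtopology M (topspace M - U))))
       (subtopology M (topspace M - U)) (subtopology M (topspace M - U)) id e"
    "q \<in> topspace (subtopology M (topspace M - U))" "q \<notin> e ` topspace (subtopology M (topspace M - U))"
proof -
  let ?E = "Euclid_set n"
  have "\<not> openin M U"
    using conn U UM openin_subset unfolding connected_space_clopen_in by blast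
  then obtain u where u: "u \<in> U" "\<And>T. openin M T \<Longrightarrow> u \<in> T \<Longrightarrow> \<not> T \<subseteq> U"
    by (subst (asm) openin_subopen) blast
  have "locally_modelled_at M (top_of_set ?E) u"
    using u(1) int by (auto simp: manifold_interior_def Euclidean_space_eq)
  then obtain V W \<phi> \<psi> where V: "openin M V" "u \<in> V" and W: "openin (top_of_set ?E) W"
      and chart: "homeomorphic_maps (subtopology M V) (top_of_set W) \<phi> \<psi>"
    by (rule locally_modelled_at_obtain)
  have VM: "V \<subseteq> topspace M" using V openin_subset by blast
  have \<psi>: "continuous_map (top_of_set W) (subtopology M V) \<psi>"
    and \<psi>\<phi>: "\<And>x. x \<in> V \<Longrightarrow> \<psi> (\<phi> x) = x" and \<phi>\<psi>: "\<And>y. y \<in> W \<Longrightarrow> \<phi> (\<psi> y) = y"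
    and \<psi>V: "\<And>y. y \<in> W \<Longrightarrow> \<psi> y \<in> V" and \<phi>W: "\<And>x. x \<in> V \<Longrightarrow> \<phi> x \<in> W"
    using chart VM by (auto simp: homeomorphic_maps_def continuous_map_def)
  have WE: "W \<subseteq> ?E" using openin_subset[OF W] by simp
  define w where "w = \<phi> u"
  have wW: "w \<in> W" using V \<phi>W by (simp add: w_def)
  define dist where "dist x y = l1norm n (\<lambda>i. x i - y i)" for x y
  have tri: "dist x z \<le> dist x y + dist y z" for x y z
    unfolding dist_def by (rule l1norm_triangle_diff)
  have comm: "dist x y = dist y x" for x y
    unfolding dist_def by (rule l1norm_minus_commute)
  obtain R where R: "R > 0" "\<And>y. y \<in> ?E \<Longrightarrow> dist y w \<le> R \<Longrightarrow> y \<in> W"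
    using openin_contains_l1_ball[OF W wW order_refl] unfolding dist_def by metis
  \<comment> \<open>\<open>y0\<close> lies within \<open>\<rho>\<close> of \<open>w\<close>,
    \<open>c\<close> within \<open>2 * \<rho>\<close>, and the ball of radius
    \<open>r < \<rho>\<close> around \<open>c\<close> within \<open>3 * \<rho> = R\<close>, hence
    inside \<open>W\<close>.\<close>
  define \<rho> where "\<rho> = R / 3"
  have \<rho>: "\<rho> > 0" using R by (simp add: \<rho>_def)
  have "continuous_on W (\<lambda>y. dist y w)" unfolding dist_def by (intro continuous_intros)
  then have "openin (top_of_set W) (W \<inter> (\<lambda>y. dist y w) -` {..<\<rho>})"
    by (rule continuous_openin_preimage_gen) simp
  then have "openin M {x \<in> V. \<phi> x \<in> W \<inter> (\<lambda>y. dist y w) -` {..<\<rho>}}"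
    by (rule homeomorphic_maps_restrict_open(1)[OF V(1) chart])
  moreover have "dist w w = 0" by (simp add: dist_def l1norm_def)
  ultimately have "\<not> {x \<in> V. \<phi> x \<in> W \<inter> (\<lambda>y. dist y w) -` {..<\<rho>}} \<subseteq> U"
    using u(2) V(2) wW \<rho> by (auto simp: w_def)
  then obtain x where x: "x \<in> V" "x \<notin> U" "dist (\<phi> x) w < \<rho>" by auto
  define y0 where "y0 = \<phi> x"
  have y0: "y0 \<in> W" "dist y0 w < \<rho>" using x \<phi>W by (simp_all add: y0_def)
  \<comment> \<open>The bound \<open>2 * \<rho>\<close> makes \<open>K\<close> compact without
    losing relevant points: whatever is nearer to \<open>y0\<close> than \<open>r\<close> is within
    \<open>2 * \<rho>\<close> of \<open>w\<close>.\<close>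
  define K where "K = {y \<in> W. \<psi> y \<in> U} \<inter> {y \<in> ?E. dist y w \<le> 2 * \<rho>}"
  have "closedin (top_of_set W) {y \<in> W. \<psi> y \<in> U}"
  proof -
    have "continuous_map (top_of_set W) M \<psi>" using \<psi> by (simp add: continuous_map_in_subtopology)
    from closedin_continuous_map_preimage[OF this U] show ?thesis by simp
  qed
  then obtain F where F: "closed F" "{y \<in> W. \<psi> y \<in> U} = W \<inter> F" by (auto simp: closedin_closed)
  have "{y \<in> ?E. dist y w \<le> 2 * \<rho>} \<subseteq> W" using R \<rho> by (auto simp: \<rho>_def)
  then have "K = {y \<in> ?E. l1norm n (\<lambda>i. y i - w i) \<le> 2 * \<rho>} \<inter> F"
    unfolding K_def F(2) dist_def by auto
  then have "compact K"
    using wW WE by (simp add: compact_Int_closed[OF compact_l1_ball F(1)] subset_iff)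
  moreover have wK: "w \<in> K"
    using wW WE u(1) V(2) \<psi>\<phi> \<rho> \<open>dist w w = 0\<close> by (auto simp: K_def w_def)
  moreover have "continuous_on K (\<lambda>y. dist y y0)" unfolding dist_def by (intro continuous_intros)
  ultimately obtain c where c: "c \<in> K" "\<And>y. y \<in> K \<Longrightarrow> dist c y0 \<le> dist y y0"
    using continuous_attains_inf[of K "\<lambda>y. dist y y0"] by blast
  \<comment> \<open>As \<open>c\<close> is a point of \<open>U\<close> nearest to \<open>y0\<close>, the cone with apex \<open>c\<close> over a small ball around \<open>y0\<close> misses \<open>U\<close>.\<close>
  have cW: "c \<in> W" "\<psi> c \<in> U" "c \<in> ?E" using c(1) by (auto simp: K_def)
  define v where "v i = y0 i - c i" for i
  define r where "r = dist c y0"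
  have r\<rho>: "r < \<rho>" using c(2)[OF wK] y0 comm by (auto simp: r_def)
  have "r \<noteq> 0"
  proof
    assume "r = 0"
    then have "c = y0" using l1norm_diff_eq_0D[of c n y0] cW y0 WE by (auto simp: r_def dist_def)
    then show False using cW x \<psi>\<phi> by (simp add: y0_def)
  qed
  then have r: "r > 0" using l1norm_nonneg[of n "\<lambda>i. c i - y0 i"] by (simp add: r_def dist_def order_less_le)
  have vE: "v \<in> ?E" using cW y0 WE by (auto simp: v_def Euclid_set_def)
  have vr: "l1norm n v = r" using comm[of c y0] unfolding v_def r_def dist_def by simp
  define D where "D = \<phi> ` (V \<inter> (topspace M - U))"
  have D: "D = {y \<in> W. \<psi> y \<notin> U}"
    unfolding D_def using \<psi>\<phi> \<phi>\<psi> \<psi>V \<phi>W VM by (force intro: image_eqI[of _ _ "\<psi> _"])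
  have DE: "D \<subseteq> ?E" using D WE by auto
  have cD: "c \<notin> D" using cW D by auto
  have cone: "(\<lambda>i. c i + s * (v i + d i)) \<in> D"
    if s: "0 < s" "s \<le> 1" and d: "d \<in> ?E" "l1norm n d \<le> r / 2" for s d
  proof -
    let ?y = "\<lambda>i. c i + s * (v i + d i)"
    have yE: "?y \<in> ?E" using cW vE d by (auto simp: Euclid_set_def)
    \<comment> \<open>As \<open>y0 = c + v\<close>, the cone point differs from \<open>y0\<close> by
      \<open>(s - 1) * v + s * d\<close>. Since \<open>s > 0\<close>, it turns out strictly nearer
      to \<open>y0\<close> than \<open>c\<close> is.\<close>
    have "dist ?y y0 = l1norm n (\<lambda>i. (s - 1) * v i + s * d i)"
      unfolding dist_def by (simp add: v_def algebra_simps)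
    also have "\<dots> \<le> l1norm n (\<lambda>i. (s - 1) * v i) + l1norm n (\<lambda>i. s * d i)" by (rule l1norm_triangle)
    also have "\<dots> = (1 - s) * r + s * l1norm n d" using s vr by (simp add: l1norm_scale)
    also have "\<dots> \<le> (1 - s) * r + s * (r / 2)" using s d by (intro add_left_mono mult_left_mono) auto
    also have "\<dots> < r" using s r by (simp add: algebra_simps)
    finally have yr: "dist ?y y0 < r" .
    then have "dist ?y w < 2 * \<rho>" using tri[of ?y w y0] y0 r\<rho> by linarith
    moreover have "?y \<in> W" using calculation R(2)[OF yE] \<rho> by (simp add: \<rho>_def)
    moreover have "?y \<notin> K" using yr c(2)[of ?y] by (auto simp: r_def)
    ultimately show ?thesis using yE by (auto simp: D K_def)
  qed
  obtain G :: "real \<times> (nat \<Rightarrow> real) \<Rightarrow> nat \<Rightarrow> real" and p where G: "continuous_on ({0..1} \<times> D) G" "G \<in> {0..1} \<times> D \<rightarrow> D"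
    "\<And>t. t \<in> {0..1} \<Longrightarrow> inj_on (\<lambda>y. G (t, y)) D"
    "\<And>y. y \<in> D \<Longrightarrow> G (0, y) = y"
    "\<And>t y. y \<in> D \<Longrightarrow> r < l1norm n (\<lambda>i. y i - c i) \<Longrightarrow> G (t, y) = y"
    "p \<in> D" "p \<notin> (\<lambda>y. G (1, y)) ` D"
    by (rule cone_compression[OF DE cD cW(3) vE vr r cone]) blast+
  define A where "A = {y \<in> ?E. l1norm n (\<lambda>i. y i - c i) \<le> r}"
  show ?thesis
  proof (rule isotopy_extend_from_chart[OF _ _ V(1) chart, of "topspace M - U" A D G p])
    show "Hausdorff_space M" using M by (simp add: manifold_with_boundary_def)
    show "compact A" unfolding A_def by (rule compact_l1_ball[OF cW(3)])
    show "A \<subseteq> W"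
    proof
      fix y assume "y \<in> A"
      then have "y \<in> ?E" "dist y c \<le> r" by (auto simp: A_def dist_def)
      moreover have "dist c w \<le> 2 * \<rho>" using c(1) by (simp add: K_def)
      ultimately show "y \<in> W" using tri[of y w c] r\<rho> by (intro R(2)) (auto simp: \<rho>_def)
    qed
    show "D = \<phi> ` (V \<inter> (topspace M - U))" by (rule D_def)
    show "G (t, y) = y" if "y \<in> D" "y \<notin> A" for t y
      using that DE by (intro G(5)) (auto simp: A_def)
  qed (use G that in auto)
qed

section \<open>Monotonicity of the Betti numbers\<close>

lemma unordered_config_space_empty:
  assumes "topspace X = {}" "1 \<le> k"
  shows "unordered_config_space k X = trivial_topology"
proof -
  have "topspace (ordered_config_space k X) = {}"
    using assms by (force simp: topspace_ordered_config_space PiE_iff)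
  then show ?thesis
    using topspace_unordered_config_space[of k X] by (simp flip: null_topspace_iff_trivial)
qed

lemma exists_config_stabilization:
  assumes M: "manifold_with_boundary n M" and conn: "connected_space M" and U: "closedin M U"
    and disj: "manifold_boundary n M \<inter> U = {}" and nonempty: "manifold_boundary n M \<union> U \<noteq> {}"
    and MU: "topspace M - U \<noteq> {}"
  obtains e q where "config_stabilization (subtopology M (topspace M - U)) e q"
proof -
  let ?X = "subtopology M (topspace M - U)"
  have X: "Hausdorff_space ?X"
    using M by (simp add: manifold_with_boundary_def Hausdorff_space_subtopology)
  show ?thesis
  \<comment> \<open>If there is no boundary, every point of \<open>M\<close> is interior and
    \<open>U\<close> is nonempty. A boundary point, if there is one, is outside \<open>U\<close> and
    serves as the end even when \<open>U\<close> is empty.\<close>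
  proof (cases "manifold_boundary n M = {}")
    case True
    then have "U \<subseteq> manifold_interior n M" "U \<noteq> {}"
      using closedin_subset[OF U] nonempty by (auto simp: manifold_boundary_def)
    from push_off_puncture[OF M conn U this(2) MU this(1)] show ?thesis
      using that X by (metis config_stabilization.intro)
  next
    case False
    then obtain b where "b \<in> manifold_boundary n M" "b \<notin> U" using disj by blast
    from push_off_boundary[OF M U this] show ?thesis
      using that X by (metis config_stabilization.intro)
  qed
qed

theorem theorem3:
  fixes M :: "'a topology" and U :: "'a set" and n i :: nat
  assumes "orientable_manifold n M"
    and "connected_space M"
    and "closedin M U"
    and "manifold_boundary n M \<inter> U = {}"
    and "connected_space (subtopology M (topspace M - U))"
    and "finite_type M"
    and "finite_type (subtopology M (topspace M - U))"
    and "manifold_boundary n M \<union> U \<noteq> {}"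
  shows "mono_on {1..} (\<lambda>k. betti i (unordered_config_space k (subtopology M (topspace M - U))))"
proof -
  let ?X = "subtopology M (topspace M - U)"
  let ?\<beta> = "\<lambda>k. betti i (unordered_config_space k ?X)"
  show "mono_on {1..} ?\<beta>"
  \<comment> \<open>Here the range \<open>k \<ge> 1\<close> matters: all configuration spaces of the
    empty space with \<open>k \<ge> 1\<close> are empty, whereas the one for \<open>k = 0\<close> is
    a point.\<close>
  proof (cases "topspace M - U = {}")
    case True
    then have "topspace ?X = {}" by (simp only: topspace_subtopology Int_empty_right)
    then show ?thesis by (auto intro!: mono_onI simp: unordered_config_space_empty)
  next
    case False
    have "manifold_with_boundary n M" using assms(1) by (simp add: orientable_manifold_def)
    then obtain e q where "config_stabilization ?X e q"
      using exists_config_stabilization assms(2-4,8) False by blast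
    then have "?\<beta> k \<le> ?\<beta> (Suc k)" for k
      by (rule config_stabilization.betti_config_le)
    then have "mono ?\<beta>" by (simp add: mono_iff_le_Suc)
    then show ?thesis by (rule mono_on_subset) simp
  qed
qed

end
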